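(* Let $p$ be a prime, $n\ge 1$ an integer, and let $F$ be a finite field of characteristic $p$ with $q=p^n$ elements. Let $U(F[C_4\times C_2^3])$ be the unit group of the group algebra $F[C_4\times C_2^3]$. (1) If $p=2$, then $$U(F[C_4\times C_2^3])\cong C_{4}^{n}\times C_{2}^{29n}\times C_{2^n-1}.$$ (2) If $p\neq 2$, then $U(F[C_4\times C_2^3])$ is isomorphic to: - $C_{p^n-1}^{32}$, if $q\equiv 1\pmod 4$; - $C_{p^n-1}^{16}\times C_{p^{2n}-1}^{8}$, if $q\equiv -1\pmod 4$.
   Context: $C_m$ denotes the cyclic group of order $m$, and $C_m^k$ denotes the direct product of $k$ copies of $C_m$. For a group $G$ and a field $F$, $FG$ (also written $F[G]$) is the group algebra and $U(FG)$ is the multiplicative group of all its invertible elements. *)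

theory Defs
  imports
    "HOL-Algebra.Ring"
    "HOL-Algebra.Elementary_Groups"
    "HOL-Algebra.Product_Groups"
    "HOL-Computational_Algebra.Primes"
    "HOL-Number_Theory.Cong"
begin

definition ring_characteristic :: "('a, 'b) ring_scheme \<Rightarrow> nat" where
  "ring_characteristic R =
     (if \<exists>k::nat. k > 0 \<and> [k] \<cdot>\<^bsub>R\<^esub> \<one>\<^bsub>R\<^esub> = \<zero>\<^bsub>R\<^esub>
      then LEAST k::nat. k > 0 \<and> [k] \<cdot>\<^bsub>R\<^esub> \<one>\<^bsub>R\<^esub> = \<zero>\<^bsub>R\<^esub>
      else 0)"

text \<open>A function \<open>f\<close> in the carrier stands for the formal sum of the terms \<open>f x\<close> times \<open>x\<close>,
  for \<open>x\<close> in \<open>G\<close>. Functions are extensional (\<open>undefined\<close> outside \<open>carrier G\<close>), so that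
  distinct functions are distinct elements. The coefficient of \<open>x\<close> in a product collects all
  \<open>f y\<close> times \<open>h z\<close> with \<open>y z = x\<close>, that is, \<open>z = y\<inverse> x\<close>; the sum runs over the
  finite support of \<open>f\<close> because \<^const>\<open>finsum\<close> over an infinite set is zero by convention.\<close>

definition group_algebra ::
    "('a, 'b) ring_scheme \<Rightarrow> ('g, 'c) monoid_scheme \<Rightarrow> ('g \<Rightarrow> 'a) ring" where
  "group_algebra F G =
     \<lparr>carrier = {f \<in> carrier G \<rightarrow>\<^sub>E carrier F. finite {x \<in> carrier G. f x \<noteq> \<zero>\<^bsub>F\<^esub>}},
      monoid.mult = (\<lambda>f h. \<lambda>x\<in>carrier G.
        finsum F (\<lambda>y. f y \<otimes>\<^bsub>F\<^esub> h (inv\<^bsub>G\<^esub> y \<otimes>\<^bsub>G\<^esub> x)) {y \<in> carrier G. f y \<noteq> \<zero>\<^bsub>F\<^esub>}),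
      monoid.one = (\<lambda>x\<in>carrier G. if x = \<one>\<^bsub>G\<^esub> then \<one>\<^bsub>F\<^esub> else \<zero>\<^bsub>F\<^esub>),
      ring.zero = (\<lambda>x\<in>carrier G. \<zero>\<^bsub>F\<^esub>),
      ring.add = (\<lambda>f h. \<lambda>x\<in>carrier G. f x \<oplus>\<^bsub>F\<^esub> h x)\<rparr>"

abbreviation cyclic_power :: "nat \<Rightarrow> nat \<Rightarrow> (nat \<Rightarrow> int) monoid" where
  "cyclic_power m k \<equiv> product_group {..<k} (\<lambda>_. integer_mod_group m)"

end

theory Submission
  imports Defs "HOL-Algebra.Multiplicative_Group"
begin

text \<open>Let \<open>G = C\<^sub>4 \<times> C\<^sub>2\<^sup>3\<close>. For odd \<open>p\<close> the group algebra is analysed by the discrete Fourier transform. With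
  \<open>i\<^sup>2 = - 1\<close>, the characters of \<open>G\<close> are \<open>b(g, \<cdot>)\<close> for the pairing \<open>b(g, h) = i\<^bsup>B(g, h)\<^esup>\<close>,
  \<open>B((j, s), (a, t)) = j a + 2 (s\<^sub>0 t\<^sub>0 + s\<^sub>1 t\<^sub>1 + s\<^sub>2 t\<^sub>2)\<close>. Orthogonality makes the transform injective, and counting
  makes it bijective. If \<open>q \<equiv> 1\<close> modulo 4 then \<open>i\<close> lies in \<open>F\<close> and \<open>FG\<close> is \<open>F\<^bsup>32\<^esup>\<close>; if \<open>q \<equiv> - 1\<close>, the values
  lie in the field \<open>F[i]\<close> with \<open>q\<^sup>2\<close> elements, 16 of them in \<open>F\<close>, and the other 16 form 8 conjugate pairs.

  For \<open>p = 2\<close>, the coefficient of \<open>f\<^sup>2\<close> at \<open>x\<close> is the sum of the \<open>f(y)\<^sup>2\<close> with \<open>y\<^sup>2 = x\<close>, since all other products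
  cancel in pairs. Hence \<open>f\<^sup>4 = \<epsilon>(f)\<^sup>4\<close> for the augmentation \<open>\<epsilon>\<close>, and \<open>f\<close> is a unit iff \<open>\<epsilon>(f) \<noteq> 0\<close>. The units are
  the product of \<open>F\<^sup>*\<close> and the group \<open>V\<close> given by \<open>\<epsilon> = 1\<close>, which has exponent 4, order \<open>q\<^bsup>31\<^esup>\<close>, and exactly
  \<open>q\<close> squares; this determines \<open>V\<close>.\<close>

section \<open>Group algebras of finite commutative groups\<close>

text \<open>Units depend on multiplication alone, so FG enters only as a commutative monoid, and the
  transform only has to be a multiplicative bijection. The form B is symmetric and nondegenerate
  modulo 4; it identifies G with its character group, so one formula supplies all 32 characters. In
  characteristic 2 the decisive feature of G is that it has just one nontrivial square, c, the
  square of a generator of the factor \<open>C_4\<close>. Squares in FG are therefore supported on 1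
  and c, and a square of augmentation 1 has the form (1 + b) + b c with b in F. This is where the
  number q of squares comes from. If V is \<open>C_4^a x C_2^k\<close>, its squares form a group of
  order \<open>2^a\<close>, so a = n; and the order \<open>2^(31 n)\<close> forces 2 a + k = 31 n,
  which gives the exponent 29 n.\<close>

lemma (in comm_monoid) finprod_swap:
  assumes "finite A" "finite B" and "\<And>x y. x \<in> A \<Longrightarrow> y \<in> B \<Longrightarrow> f x y \<in> carrier G"
  shows "(\<Otimes>x\<in>A. \<Otimes>y\<in>B. f x y) = (\<Otimes>y\<in>B. \<Otimes>x\<in>A. f x y)"
  using assms(1,3)
proof (induction A rule: finite_induct)
  case (insert a A)
  have "(\<Otimes>x\<in>insert a A. \<Otimes>y\<in>B. f x y) = (\<Otimes>y\<in>B. f a y) \<otimes> (\<Otimes>x\<in>A. \<Otimes>y\<in>B. f x y)"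
    using insert by (intro finprod_insert) auto
  also have "\<dots> = (\<Otimes>y\<in>B. f a y) \<otimes> (\<Otimes>y\<in>B. \<Otimes>x\<in>A. f x y)"
    using insert by simp
  also have "\<dots> = (\<Otimes>y\<in>B. f a y \<otimes> (\<Otimes>x\<in>A. f x y))"
    using insert by (intro finprod_multf [symmetric]) auto
  also have "\<dots> = (\<Otimes>y\<in>B. \<Otimes>x\<in>insert a A. f x y)"
    using insert by (intro finprod_cong') auto
  finally show ?case .
qed simp

lemmas (in abelian_monoid) finsum_swap = add.finprod_swap

lemma (in abelian_monoid) finsum_bij:
  assumes "bij_betw h A B" "\<And>y. y \<in> B \<Longrightarrow> f y \<in> carrier G"
  shows "(\<Oplus>y\<in>B. f y) = (\<Oplus>x\<in>A. f (h x))"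
  using finsum_reindex[of f h A] assms by (auto simp: bij_betw_def)

text \<open>The linear extension of a character \<open>\<chi>\<close> of \<open>G\<close> to the
  group algebra, with coefficients carried into \<open>S\<close> by \<open>\<iota>\<close>. Both the
  Fourier transform (\<open>\<chi> = b g\<close>) and the augmentation (\<open>\<chi> = 1\<close>)
  are instances, so multiplicativity is proved once for both.\<close>

definition character_sum ::
    "('b, 'd) ring_scheme \<Rightarrow> ('g, 'c) monoid_scheme \<Rightarrow> ('a \<Rightarrow> 'b) \<Rightarrow> ('g \<Rightarrow> 'b) \<Rightarrow> ('g \<Rightarrow> 'a) \<Rightarrow> 'b" where
  "character_sum S G \<iota> \<chi> f = (\<Oplus>\<^bsub>S\<^esub>x\<in>carrier G. \<iota> (f x) \<otimes>\<^bsub>S\<^esub> \<chi> x)"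

locale finite_group_algebra = cring R + G: comm_group G
  for R (structure) and G (structure) +
  assumes finite_G: "finite (carrier G)"
begin

abbreviation RG where "RG \<equiv> group_algebra R G"

lemma G_cancel [simp]:
  assumes "x \<in> carrier G" "y \<in> carrier G"
  shows "inv\<^bsub>G\<^esub> y \<otimes>\<^bsub>G\<^esub> (y \<otimes>\<^bsub>G\<^esub> x) = x" "y \<otimes>\<^bsub>G\<^esub> (inv\<^bsub>G\<^esub> y \<otimes>\<^bsub>G\<^esub> x) = x"
  using assms by (simp_all flip: G.m_assoc)

lemma bij_translate: "y \<in> carrier G \<Longrightarrow> bij_betw (\<lambda>x. y \<otimes>\<^bsub>G\<^esub> x) (carrier G) (carrier G)"
  by (rule bij_betw_byWitness[where f' = "\<lambda>x. inv\<^bsub>G\<^esub> y \<otimes>\<^bsub>G\<^esub> x"]) auto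

lemma carrier_RG: "carrier RG = carrier G \<rightarrow>\<^sub>E carrier R"
  using finite_G by (auto simp: group_algebra_def)

lemma RG_closed [simp]: "f \<in> carrier RG \<Longrightarrow> x \<in> carrier G \<Longrightarrow> f x \<in> carrier R"
  by (auto simp: carrier_RG)

lemma RG_eqI: "f \<in> carrier RG \<Longrightarrow> h \<in> carrier RG \<Longrightarrow> (\<And>x. x \<in> carrier G \<Longrightarrow> f x = h x) \<Longrightarrow> f = h"
  unfolding carrier_RG by (rule PiE_ext)

lemma one_RG: "\<one>\<^bsub>RG\<^esub> = (\<lambda>x\<in>carrier G. if x = \<one>\<^bsub>G\<^esub> then \<one> else \<zero>)"
  by (simp add: group_algebra_def)

text \<open>Outside the support of \<open>f\<close> the summands vanish. Summing over the whole
  group instead of the support is what permits reindexing by translations and inversions.\<close>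

lemma mult_RG:
  assumes "f \<in> carrier RG" "h \<in> carrier RG"
  shows "f \<otimes>\<^bsub>RG\<^esub> h = (\<lambda>x\<in>carrier G. \<Oplus>y\<in>carrier G. f y \<otimes> h (inv\<^bsub>G\<^esub> y \<otimes>\<^bsub>G\<^esub> x))"
proof -
  have "(\<Oplus>y\<in>{y \<in> carrier G. f y \<noteq> \<zero>}. f y \<otimes> h (inv\<^bsub>G\<^esub> y \<otimes>\<^bsub>G\<^esub> x)) =
        (\<Oplus>y\<in>carrier G. f y \<otimes> h (inv\<^bsub>G\<^esub> y \<otimes>\<^bsub>G\<^esub> x))" if "x \<in> carrier G" for x
    using finite_G assms that
    by (intro add.finprod_mono_neutral_cong_left) auto
  then show ?thesis
    by (auto simp: group_algebra_def intro!: restrict_ext)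
qed

lemma mult_RG_apply:
  assumes "f \<in> carrier RG" "h \<in> carrier RG" "x \<in> carrier G"
  shows "(f \<otimes>\<^bsub>RG\<^esub> h) x = (\<Oplus>y\<in>carrier G. f y \<otimes> h (inv\<^bsub>G\<^esub> y \<otimes>\<^bsub>G\<^esub> x))"
  using assms by (simp add: mult_RG)

lemma RG_mult_closed [simp]:
  assumes "f \<in> carrier RG" "h \<in> carrier RG"
  shows "f \<otimes>\<^bsub>RG\<^esub> h \<in> carrier RG"
  using assms by (auto simp: mult_RG[OF assms]) (auto simp: carrier_RG intro!: finsum_closed)

lemma RG_one_closed [simp]: "\<one>\<^bsub>RG\<^esub> \<in> carrier RG"
  by (auto simp: one_RG carrier_RG)

text \<open>The substitution that sends y to y^-1 x is an involution of the group and exchanges the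
  two arguments of the convolution at x.\<close>

lemma RG_comm:
  assumes "f \<in> carrier RG" "h \<in> carrier RG"
  shows "f \<otimes>\<^bsub>RG\<^esub> h = h \<otimes>\<^bsub>RG\<^esub> f"
proof (rule RG_eqI)
  fix x assume x: "x \<in> carrier G"
  have bij: "bij_betw (\<lambda>y. inv\<^bsub>G\<^esub> y \<otimes>\<^bsub>G\<^esub> x) (carrier G) (carrier G)"
    by (rule bij_betw_byWitness[where f' = "\<lambda>y. inv\<^bsub>G\<^esub> y \<otimes>\<^bsub>G\<^esub> x"])
       (use x in \<open>auto simp: G.inv_mult G.m_assoc\<close>)
  have "(f \<otimes>\<^bsub>RG\<^esub> h) x = (\<Oplus>y\<in>carrier G. f y \<otimes> h (inv\<^bsub>G\<^esub> y \<otimes>\<^bsub>G\<^esub> x))"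
    by (rule mult_RG_apply[OF assms x])
  also have "\<dots> = (\<Oplus>y\<in>carrier G. f (inv\<^bsub>G\<^esub> y \<otimes>\<^bsub>G\<^esub> x) \<otimes> h (inv\<^bsub>G\<^esub> (inv\<^bsub>G\<^esub> y \<otimes>\<^bsub>G\<^esub> x) \<otimes>\<^bsub>G\<^esub> x))"
    by (rule finsum_bij[OF bij]) (use assms x in auto)
  also have "\<dots> = (\<Oplus>y\<in>carrier G. h y \<otimes> f (inv\<^bsub>G\<^esub> y \<otimes>\<^bsub>G\<^esub> x))"
    using assms x by (intro finsum_cong') (auto simp: G.inv_mult G.m_assoc m_comm)
  also have "\<dots> = (h \<otimes>\<^bsub>RG\<^esub> f) x"
    by (rule mult_RG_apply[symmetric]) (use assms x in auto)
  finally show "(f \<otimes>\<^bsub>RG\<^esub> h) x = (h \<otimes>\<^bsub>RG\<^esub> f) x" .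
qed (use assms in auto)

text \<open>Both sides sum f(z) g(w) h(v) over all z w v = x. After the two sums are exchanged, the
  translation y = z w turns the inner one into a convolution.\<close>

lemma RG_assoc:
  assumes "f \<in> carrier RG" "g \<in> carrier RG" "h \<in> carrier RG"
  shows "(f \<otimes>\<^bsub>RG\<^esub> g) \<otimes>\<^bsub>RG\<^esub> h = f \<otimes>\<^bsub>RG\<^esub> (g \<otimes>\<^bsub>RG\<^esub> h)"
proof (rule RG_eqI)
  fix x assume x: "x \<in> carrier G"
  have "((f \<otimes>\<^bsub>RG\<^esub> g) \<otimes>\<^bsub>RG\<^esub> h) x
      = (\<Oplus>y\<in>carrier G. (\<Oplus>z\<in>carrier G. f z \<otimes> g (inv\<^bsub>G\<^esub> z \<otimes>\<^bsub>G\<^esub> y)) \<otimes> h (inv\<^bsub>G\<^esub> y \<otimes>\<^bsub>G\<^esub> x))"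
    using assms x by (auto simp: mult_RG_apply intro!: finsum_cong')
  also have "\<dots> = (\<Oplus>y\<in>carrier G. \<Oplus>z\<in>carrier G. f z \<otimes> (g (inv\<^bsub>G\<^esub> z \<otimes>\<^bsub>G\<^esub> y) \<otimes> h (inv\<^bsub>G\<^esub> y \<otimes>\<^bsub>G\<^esub> x)))"
    using assms x finite_G
    by (intro finsum_cong')
       (auto intro!: finsum_cong' simp: finsum_ldistr m_assoc)
  also have "\<dots> = (\<Oplus>z\<in>carrier G. \<Oplus>y\<in>carrier G. f z \<otimes> (g (inv\<^bsub>G\<^esub> z \<otimes>\<^bsub>G\<^esub> y) \<otimes> h (inv\<^bsub>G\<^esub> y \<otimes>\<^bsub>G\<^esub> x)))"
    by (rule finsum_swap) (use assms x finite_G in auto)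
  also have "\<dots> = (\<Oplus>z\<in>carrier G. f z \<otimes> (\<Oplus>y\<in>carrier G. g (inv\<^bsub>G\<^esub> z \<otimes>\<^bsub>G\<^esub> y) \<otimes> h (inv\<^bsub>G\<^esub> y \<otimes>\<^bsub>G\<^esub> x)))"
    using assms x finite_G
    by (intro finsum_cong') (auto simp: finsum_rdistr)
  also have "\<dots> = (\<Oplus>z\<in>carrier G. f z \<otimes> (g \<otimes>\<^bsub>RG\<^esub> h) (inv\<^bsub>G\<^esub> z \<otimes>\<^bsub>G\<^esub> x))"
  proof (rule finsum_cong')
    fix z assume z: "z \<in> carrier G"
    have "(\<Oplus>y\<in>carrier G. g (inv\<^bsub>G\<^esub> z \<otimes>\<^bsub>G\<^esub> y) \<otimes> h (inv\<^bsub>G\<^esub> y \<otimes>\<^bsub>G\<^esub> x))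
        = (\<Oplus>w\<in>carrier G. g (inv\<^bsub>G\<^esub> z \<otimes>\<^bsub>G\<^esub> (z \<otimes>\<^bsub>G\<^esub> w)) \<otimes> h (inv\<^bsub>G\<^esub> (z \<otimes>\<^bsub>G\<^esub> w) \<otimes>\<^bsub>G\<^esub> x))"
      by (rule finsum_bij[OF bij_translate[OF z]]) (use assms x z in auto)
    also have "\<dots> = (\<Oplus>w\<in>carrier G. g w \<otimes> h (inv\<^bsub>G\<^esub> w \<otimes>\<^bsub>G\<^esub> (inv\<^bsub>G\<^esub> z \<otimes>\<^bsub>G\<^esub> x)))"
      using assms x z by (intro finsum_cong') (auto simp: G.inv_mult_group G.m_assoc)
    finally show "f z \<otimes> (\<Oplus>y\<in>carrier G. g (inv\<^bsub>G\<^esub> z \<otimes>\<^bsub>G\<^esub> y) \<otimes> h (inv\<^bsub>G\<^esub> y \<otimes>\<^bsub>G\<^esub> x))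
        = f z \<otimes> (g \<otimes>\<^bsub>RG\<^esub> h) (inv\<^bsub>G\<^esub> z \<otimes>\<^bsub>G\<^esub> x)"
      using assms x z by (simp add: mult_RG_apply)
  qed (use assms x in auto)
  also have "\<dots> = (f \<otimes>\<^bsub>RG\<^esub> (g \<otimes>\<^bsub>RG\<^esub> h)) x"
    using assms x by (simp add: mult_RG_apply)
  finally show "((f \<otimes>\<^bsub>RG\<^esub> g) \<otimes>\<^bsub>RG\<^esub> h) x = (f \<otimes>\<^bsub>RG\<^esub> (g \<otimes>\<^bsub>RG\<^esub> h)) x" .
qed (use assms in auto)

lemma RG_l_one:
  assumes "f \<in> carrier RG" shows "\<one>\<^bsub>RG\<^esub> \<otimes>\<^bsub>RG\<^esub> f = f"
proof (rule RG_eqI)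
  fix x assume x: "x \<in> carrier G"
  have "(\<one>\<^bsub>RG\<^esub> \<otimes>\<^bsub>RG\<^esub> f) x
      = (\<Oplus>y\<in>carrier G. if y = \<one>\<^bsub>G\<^esub> then f (inv\<^bsub>G\<^esub> y \<otimes>\<^bsub>G\<^esub> x) else \<zero>)"
    unfolding mult_RG_apply[OF RG_one_closed assms x]
    using assms x by (intro finsum_cong') (auto simp: one_RG)
  also have "\<dots> = f (inv\<^bsub>G\<^esub> \<one>\<^bsub>G\<^esub> \<otimes>\<^bsub>G\<^esub> x)"
    by (rule add.finprod_singleton_swap) (use assms x finite_G in auto)
  finally show "(\<one>\<^bsub>RG\<^esub> \<otimes>\<^bsub>RG\<^esub> f) x = f x" using x by simp
qed (use assms in auto)

lemma RG_comm_monoid: "comm_monoid RG"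
  by (rule comm_monoidI) (auto simp: RG_assoc RG_l_one intro: RG_comm)

lemma character_sum_closed:
  assumes "cring S" "\<iota> \<in> ring_hom R S" "\<And>x. x \<in> carrier G \<Longrightarrow> \<chi> x \<in> carrier S" "f \<in> carrier RG"
  shows "character_sum S G \<iota> \<chi> f \<in> carrier S"
proof -
  interpret S: cring S by fact
  show ?thesis
    unfolding character_sum_def using assms by (auto intro!: S.finsum_closed S.m_closed ring_hom_closed[OF assms(2)])
qed

text \<open>Because \<open>\<chi>\<close> x = \<open>\<chi>\<close> y \<open>\<chi>\<close>(y^-1 x),
  each summand splits into a factor in y and a factor in y^-1 x; translating by y makes the inner
  sum independent of y.\<close>

lemma character_sum_mult:
  assumes S: "cring S" and \<iota>: "\<iota> \<in> ring_hom R S"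
    and \<chi>: "\<And>x. x \<in> carrier G \<Longrightarrow> \<chi> x \<in> carrier S"
    and \<chi>_mult: "\<And>x y. x \<in> carrier G \<Longrightarrow> y \<in> carrier G \<Longrightarrow> \<chi> (x \<otimes>\<^bsub>G\<^esub> y) = \<chi> x \<otimes>\<^bsub>S\<^esub> \<chi> y"
    and f: "f \<in> carrier RG" and h: "h \<in> carrier RG"
  shows "character_sum S G \<iota> \<chi> (f \<otimes>\<^bsub>RG\<^esub> h) = character_sum S G \<iota> \<chi> f \<otimes>\<^bsub>S\<^esub> character_sum S G \<iota> \<chi> h"
proof -
  interpret S: cring S by fact
  interpret \<iota>: ring_hom_cring R S \<iota>
    by unfold_locales (rule \<iota>)
  have "character_sum S G \<iota> \<chi> (f \<otimes>\<^bsub>RG\<^esub> h)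
      = (\<Oplus>\<^bsub>S\<^esub>x\<in>carrier G. \<iota> (\<Oplus>y\<in>carrier G. f y \<otimes> h (inv\<^bsub>G\<^esub> y \<otimes>\<^bsub>G\<^esub> x)) \<otimes>\<^bsub>S\<^esub> \<chi> x)"
    unfolding character_sum_def using f h \<chi> by (intro S.finsum_cong') (auto simp: mult_RG_apply)
  also have "\<dots> = (\<Oplus>\<^bsub>S\<^esub>x\<in>carrier G. \<Oplus>\<^bsub>S\<^esub>y\<in>carrier G. (\<iota> (f y) \<otimes>\<^bsub>S\<^esub> \<chi> y) \<otimes>\<^bsub>S\<^esub>
      (\<iota> (h (inv\<^bsub>G\<^esub> y \<otimes>\<^bsub>G\<^esub> x)) \<otimes>\<^bsub>S\<^esub> \<chi> (inv\<^bsub>G\<^esub> y \<otimes>\<^bsub>G\<^esub> x)))"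
  proof (rule S.finsum_cong')
    fix x assume x: "x \<in> carrier G"
    have "\<iota> (\<Oplus>y\<in>carrier G. f y \<otimes> h (inv\<^bsub>G\<^esub> y \<otimes>\<^bsub>G\<^esub> x)) \<otimes>\<^bsub>S\<^esub> \<chi> x
        = (\<Oplus>\<^bsub>S\<^esub>y\<in>carrier G. \<iota> (f y \<otimes> h (inv\<^bsub>G\<^esub> y \<otimes>\<^bsub>G\<^esub> x)) \<otimes>\<^bsub>S\<^esub> \<chi> x)"
      using f h x \<chi> finite_G by (subst \<iota>.hom_finsum) (auto simp: S.finsum_ldistr Pi_def)
    also have "\<dots> = (\<Oplus>\<^bsub>S\<^esub>y\<in>carrier G. (\<iota> (f y) \<otimes>\<^bsub>S\<^esub> \<chi> y) \<otimes>\<^bsub>S\<^esub>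
      (\<iota> (h (inv\<^bsub>G\<^esub> y \<otimes>\<^bsub>G\<^esub> x)) \<otimes>\<^bsub>S\<^esub> \<chi> (inv\<^bsub>G\<^esub> y \<otimes>\<^bsub>G\<^esub> x)))"
    proof (rule S.finsum_cong')
      fix y assume y: "y \<in> carrier G"
      have "\<chi> x = \<chi> y \<otimes>\<^bsub>S\<^esub> \<chi> (inv\<^bsub>G\<^esub> y \<otimes>\<^bsub>G\<^esub> x)"
        using \<chi>_mult[of y "inv\<^bsub>G\<^esub> y \<otimes>\<^bsub>G\<^esub> x"] x y by simp
      then show "\<iota> (f y \<otimes> h (inv\<^bsub>G\<^esub> y \<otimes>\<^bsub>G\<^esub> x)) \<otimes>\<^bsub>S\<^esub> \<chi> x = (\<iota> (f y) \<otimes>\<^bsub>S\<^esub> \<chi> y) \<otimes>\<^bsub>S\<^esub>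
        (\<iota> (h (inv\<^bsub>G\<^esub> y \<otimes>\<^bsub>G\<^esub> x)) \<otimes>\<^bsub>S\<^esub> \<chi> (inv\<^bsub>G\<^esub> y \<otimes>\<^bsub>G\<^esub> x))"
        using f h x y \<chi> by (simp add: S.m_ac)
    qed (use f h x \<chi> in auto)
    finally show "\<iota> (\<Oplus>y\<in>carrier G. f y \<otimes> h (inv\<^bsub>G\<^esub> y \<otimes>\<^bsub>G\<^esub> x)) \<otimes>\<^bsub>S\<^esub> \<chi> x = \<dots>" .
  qed (use f h \<chi> in auto)
  also have "\<dots> = (\<Oplus>\<^bsub>S\<^esub>y\<in>carrier G. \<Oplus>\<^bsub>S\<^esub>x\<in>carrier G. (\<iota> (f y) \<otimes>\<^bsub>S\<^esub> \<chi> y) \<otimes>\<^bsub>S\<^esub>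
      (\<iota> (h (inv\<^bsub>G\<^esub> y \<otimes>\<^bsub>G\<^esub> x)) \<otimes>\<^bsub>S\<^esub> \<chi> (inv\<^bsub>G\<^esub> y \<otimes>\<^bsub>G\<^esub> x)))"
    by (rule S.finsum_swap) (use f h \<chi> finite_G in auto)
  also have "\<dots> = (\<Oplus>\<^bsub>S\<^esub>y\<in>carrier G. (\<iota> (f y) \<otimes>\<^bsub>S\<^esub> \<chi> y) \<otimes>\<^bsub>S\<^esub> character_sum S G \<iota> \<chi> h)"
  proof (rule S.finsum_cong')
    fix y assume y: "y \<in> carrier G"
    have "(\<Oplus>\<^bsub>S\<^esub>x\<in>carrier G. (\<iota> (f y) \<otimes>\<^bsub>S\<^esub> \<chi> y) \<otimes>\<^bsub>S\<^esub>
        (\<iota> (h (inv\<^bsub>G\<^esub> y \<otimes>\<^bsub>G\<^esub> x)) \<otimes>\<^bsub>S\<^esub> \<chi> (inv\<^bsub>G\<^esub> y \<otimes>\<^bsub>G\<^esub> x)))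
        = (\<iota> (f y) \<otimes>\<^bsub>S\<^esub> \<chi> y) \<otimes>\<^bsub>S\<^esub>
          (\<Oplus>\<^bsub>S\<^esub>x\<in>carrier G. \<iota> (h (inv\<^bsub>G\<^esub> y \<otimes>\<^bsub>G\<^esub> x)) \<otimes>\<^bsub>S\<^esub> \<chi> (inv\<^bsub>G\<^esub> y \<otimes>\<^bsub>G\<^esub> x))"
      using f h y \<chi> finite_G by (intro S.finsum_rdistr [symmetric]) auto
    also have "(\<Oplus>\<^bsub>S\<^esub>x\<in>carrier G. \<iota> (h (inv\<^bsub>G\<^esub> y \<otimes>\<^bsub>G\<^esub> x)) \<otimes>\<^bsub>S\<^esub> \<chi> (inv\<^bsub>G\<^esub> y \<otimes>\<^bsub>G\<^esub> x))
        = character_sum S G \<iota> \<chi> h"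
      unfolding character_sum_def
      by (rule S.finsum_bij[OF bij_translate, symmetric]) (use h y \<chi> in auto)
    finally show "(\<Oplus>\<^bsub>S\<^esub>x\<in>carrier G. (\<iota> (f y) \<otimes>\<^bsub>S\<^esub> \<chi> y) \<otimes>\<^bsub>S\<^esub>
        (\<iota> (h (inv\<^bsub>G\<^esub> y \<otimes>\<^bsub>G\<^esub> x)) \<otimes>\<^bsub>S\<^esub> \<chi> (inv\<^bsub>G\<^esub> y \<otimes>\<^bsub>G\<^esub> x)))
        = (\<iota> (f y) \<otimes>\<^bsub>S\<^esub> \<chi> y) \<otimes>\<^bsub>S\<^esub> character_sum S G \<iota> \<chi> h" .
  qed (use f h \<chi> S \<iota> in \<open>auto intro!: character_sum_closed\<close>)
  also have "\<dots> = character_sum S G \<iota> \<chi> f \<otimes>\<^bsub>S\<^esub> character_sum S G \<iota> \<chi> h"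
    using f h \<chi> S \<iota> finite_G
    by (subst S.finsum_ldistr [symmetric]) (auto intro!: character_sum_closed simp: character_sum_def[of S G \<iota> \<chi> f])
  finally show ?thesis .
qed

lemma character_sum_one:
  assumes S: "cring S" and \<iota>: "\<iota> \<in> ring_hom R S"
    and \<chi>: "\<And>x. x \<in> carrier G \<Longrightarrow> \<chi> x \<in> carrier S" "\<chi> \<one>\<^bsub>G\<^esub> = \<one>\<^bsub>S\<^esub>"
  shows "character_sum S G \<iota> \<chi> \<one>\<^bsub>RG\<^esub> = \<one>\<^bsub>S\<^esub>"
proof -
  interpret S: cring S by fact
  interpret \<iota>: ring_hom_cring R S \<iota>
    by unfold_locales (rule \<iota>)
  have "character_sum S G \<iota> \<chi> \<one>\<^bsub>RG\<^esub> = (\<Oplus>\<^bsub>S\<^esub>x\<in>carrier G. if x = \<one>\<^bsub>G\<^esub> then \<chi> x else \<zero>\<^bsub>S\<^esub>)"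
    unfolding character_sum_def using \<chi> by (intro S.finsum_cong') (auto simp: one_RG)
  also have "\<dots> = \<chi> \<one>\<^bsub>G\<^esub>"
    by (rule S.add.finprod_singleton_swap) (use \<chi> finite_G in auto)
  finally show ?thesis using \<chi> by simp
qed

end

section \<open>Isomorphisms with products of cyclic groups\<close>

text \<open>Any multiplicative bijection preserving 1 restricts to the units. For surjectivity, a
  unit and its inverse are both pulled back, and injectivity shows that the preimages are inverse to
  each other.\<close>

lemma units_of_iso:
  assumes hom: "\<phi> \<in> hom A B" and one: "\<phi> \<one>\<^bsub>A\<^esub> = \<one>\<^bsub>B\<^esub>" and bij: "bij_betw \<phi> (carrier A) (carrier B)"
    and A: "monoid A"
  shows "units_of A \<cong> units_of B"
proof -
  interpret A: monoid A by fact
  have inj: "inj_on \<phi> (carrier A)" and surj: "\<phi> ` carrier A = carrier B"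
    using bij by (auto simp: bij_betw_def)
  have "\<phi> x \<in> Units B" if "x \<in> Units A" for x
  proof -
    have "\<phi> (inv\<^bsub>A\<^esub> x) \<otimes>\<^bsub>B\<^esub> \<phi> x = \<one>\<^bsub>B\<^esub>" "\<phi> x \<otimes>\<^bsub>B\<^esub> \<phi> (inv\<^bsub>A\<^esub> x) = \<one>\<^bsub>B\<^esub>"
      using that by (simp_all add: hom_mult[OF hom, symmetric] one A.Units_closed)
    then show ?thesis
      using that hom_in_carrier[OF hom] by (auto simp: Units_def[of B] A.Units_closed)
  qed
  moreover have "\<exists>x\<in>Units A. y = \<phi> x" if "y \<in> Units B" for y
  proof -
    from that obtain z where y: "y \<in> carrier B" and z: "z \<in> carrier B"
      and yz: "y \<otimes>\<^bsub>B\<^esub> z = \<one>\<^bsub>B\<^esub>" "z \<otimes>\<^bsub>B\<^esub> y = \<one>\<^bsub>B\<^esub>" by (auto simp: Units_def)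
    have "y \<in> \<phi> ` carrier A" "z \<in> \<phi> ` carrier A" using y z surj by auto
    then obtain u v where uv: "u \<in> carrier A" "v \<in> carrier A" "y = \<phi> u" "z = \<phi> v"
      by (elim imageE)
    have "\<phi> (u \<otimes>\<^bsub>A\<^esub> v) = \<phi> \<one>\<^bsub>A\<^esub>" "\<phi> (v \<otimes>\<^bsub>A\<^esub> u) = \<phi> \<one>\<^bsub>A\<^esub>"
      using uv yz hom_mult[OF hom] one by auto
    then have "u \<otimes>\<^bsub>A\<^esub> v = \<one>\<^bsub>A\<^esub>" "v \<otimes>\<^bsub>A\<^esub> u = \<one>\<^bsub>A\<^esub>"
      using uv by (auto dest: inj_onD[OF inj])
    with uv show ?thesis by (auto simp: Units_def)
  qed
  ultimately have "\<phi> ` Units A = Units B" by blast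
  moreover have "inj_on \<phi> (Units A)"
    using inj by (rule inj_on_subset) (auto simp: A.Units_closed)
  ultimately have "\<phi> \<in> iso (units_of A) (units_of B)"
    using hom_mult[OF hom]
    by (auto simp: iso_def hom_def bij_betw_def units_of_carrier units_of_mult A.Units_closed)
  then show ?thesis by (rule is_isoI)
qed

text \<open>An equality and not merely an isomorphism: elements of a product are extensional
  functions, and invertibility is decided coordinatewise. It can thus be used for rewriting.\<close>

lemma units_of_product_group:
  "units_of (product_group I M) = product_group I (\<lambda>i. units_of (M i))"
proof -
  have "Units (product_group I M) = (\<Pi>\<^sub>E i\<in>I. Units (M i))"
  proof (intro equalityI subsetI)
    fix f assume "f \<in> Units (product_group I M)"
    then obtain g where f: "f \<in> (\<Pi>\<^sub>E i\<in>I. carrier (M i))" and g: "g \<in> (\<Pi>\<^sub>E i\<in>I. carrier (M i))"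
      and eq: "(\<lambda>i\<in>I. g i \<otimes>\<^bsub>M i\<^esub> f i) = (\<lambda>i\<in>I. \<one>\<^bsub>M i\<^esub>)" "(\<lambda>i\<in>I. f i \<otimes>\<^bsub>M i\<^esub> g i) = (\<lambda>i\<in>I. \<one>\<^bsub>M i\<^esub>)"
      by (auto simp: Units_def)
    have "g i \<otimes>\<^bsub>M i\<^esub> f i = \<one>\<^bsub>M i\<^esub>" "f i \<otimes>\<^bsub>M i\<^esub> g i = \<one>\<^bsub>M i\<^esub>" if "i \<in> I" for i
      using fun_cong[OF eq(1), of i] fun_cong[OF eq(2), of i] that by simp_all
    with f g have "f i \<in> Units (M i)" if "i \<in> I" for i
      using that unfolding Units_def by (auto intro!: bexI[of _ "g i"])
    with f show "f \<in> (\<Pi>\<^sub>E i\<in>I. Units (M i))" by auto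
  next
    fix f assume f: "f \<in> (\<Pi>\<^sub>E i\<in>I. Units (M i))"
    then have "\<forall>i\<in>I. \<exists>g\<in>carrier (M i). g \<otimes>\<^bsub>M i\<^esub> f i = \<one>\<^bsub>M i\<^esub> \<and> f i \<otimes>\<^bsub>M i\<^esub> g = \<one>\<^bsub>M i\<^esub>"
      by (auto simp: Units_def)
    then obtain g where "\<forall>i\<in>I. g i \<in> carrier (M i) \<and> g i \<otimes>\<^bsub>M i\<^esub> f i = \<one>\<^bsub>M i\<^esub> \<and> f i \<otimes>\<^bsub>M i\<^esub> g i = \<one>\<^bsub>M i\<^esub>"
      by metis
    with f show "f \<in> Units (product_group I M)"
      by (auto simp: Units_def intro!: bexI[of _ "restrict g I"] restrict_ext)
  qed
  then show ?thesis
    by (simp add: units_of_def product_group_def)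
qed

lemma units_of_DirProd: "units_of (A \<times>\<times> B) = units_of A \<times>\<times> units_of B"
proof -
  have "Units (A \<times>\<times> B) = Units A \<times> Units B"
  proof (intro equalityI subsetI)
    fix x assume "x \<in> Units (A \<times>\<times> B)"
    then obtain y where "x \<in> carrier A \<times> carrier B" "y \<in> carrier A \<times> carrier B"
      "y \<otimes>\<^bsub>A \<times>\<times> B\<^esub> x = \<one>\<^bsub>A \<times>\<times> B\<^esub>" "x \<otimes>\<^bsub>A \<times>\<times> B\<^esub> y = \<one>\<^bsub>A \<times>\<times> B\<^esub>"
      by (auto simp: Units_def)
    then show "x \<in> Units A \<times> Units B"
      by (cases x, cases y) (auto simp: Units_def)
  next
    fix x assume x: "x \<in> Units A \<times> Units B"
    then obtain u v where "u \<in> carrier A" "u \<otimes>\<^bsub>A\<^esub> fst x = \<one>\<^bsub>A\<^esub>" "fst x \<otimes>\<^bsub>A\<^esub> u = \<one>\<^bsub>A\<^esub>"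
      "v \<in> carrier B" "v \<otimes>\<^bsub>B\<^esub> snd x = \<one>\<^bsub>B\<^esub>" "snd x \<otimes>\<^bsub>B\<^esub> v = \<one>\<^bsub>B\<^esub>"
      by (auto simp: Units_def)
    with x show "x \<in> Units (A \<times>\<times> B)"
      by (cases x) (auto simp: Units_def intro!: bexI[of _ "(u, v)"])
  qed
  then show ?thesis
    by (simp add: units_of_def DirProd_def)
qed

lemma DirProd_cong_iso:
  assumes "group A" "group B" "A \<cong> A'" "B \<cong> B'"
  shows "A \<times>\<times> B \<cong> A' \<times>\<times> B'"
proof -
  obtain f g where "f \<in> iso A A'" "g \<in> iso B B'"
    using assms(3,4) by (auto simp: is_iso_def)
  then have "(\<lambda>(x, y). (f x, g y)) \<in> iso (A \<times>\<times> B) (A' \<times>\<times> B')"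
    using iso_paired2[OF assms(1,2)] by blast
  then show ?thesis by (rule is_isoI)
qed

lemma product_group_reindex_iso:
  assumes h: "bij_betw h I J"
  shows "product_group J (\<lambda>_. A) \<cong> product_group I (\<lambda>_. A)"
proof (rule is_isoI, rule isoI)
  show "(\<lambda>f. \<lambda>i\<in>I. f (h i)) \<in> hom (product_group J (\<lambda>_. A)) (product_group I (\<lambda>_. A))"
    using h by (intro homI) (auto simp: bij_betw_def intro!: restrict_ext)
  have inj: "inj_on h I" and img: "h ` I = J" using h by (auto simp: bij_betw_def)
  have inv: "inv_into I h j \<in> I" "h (inv_into I h j) = j" if "j \<in> J" for j
    using that img by (auto intro: inv_into_into f_inv_into_f)
  show "bij_betw (\<lambda>f. \<lambda>i\<in>I. f (h i)) (carrier (product_group J (\<lambda>_. A))) (carrier (product_group I (\<lambda>_. A)))"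
  proof (rule bij_betw_byWitness[where f' = "\<lambda>f. \<lambda>j\<in>J. f (inv_into I h j)"])
    show "\<forall>a\<in>carrier (product_group J (\<lambda>_. A)). (\<lambda>j\<in>J. (\<lambda>i\<in>I. a (h i)) (inv_into I h j)) = a"
      using inv by (auto intro!: PiE_ext[of _ J "\<lambda>_. carrier A"])
    show "\<forall>a\<in>carrier (product_group I (\<lambda>_. A)). (\<lambda>i\<in>I. (\<lambda>j\<in>J. a (inv_into I h j)) (h i)) = a"
      using inj img by (auto intro!: PiE_ext[of _ I "\<lambda>_. carrier A"])
  qed (use inv img in auto)
qed

text \<open>Turns products indexed by group elements into the powers indexed by an initial segment
  that \<open>cyclic_power\<close> uses.\<close>

lemma product_group_card_iso:
  assumes "finite I" "card I = n"
  shows "product_group I (\<lambda>_. A) \<cong> product_group {..<n} (\<lambda>_. A)"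
proof -
  obtain h where "bij_betw h {..<n} I"
    using ex_bij_betw_nat_finite[OF assms(1)] assms(2) by (auto simp: atLeast0LessThan)
  then show ?thesis by (rule product_group_reindex_iso)
qed

section \<open>Homomorphisms out of products of cyclic groups, and counting by kernel and
  image\<close>

lemma (in group) hom_integer_mod_group_pow:
  assumes x: "x \<in> carrier G" and m: "m > 0" "x [^] (m::nat) = \<one>"
  shows "(\<lambda>k::int. x [^] k) \<in> hom (integer_mod_group m) G"
proof -
  have "x [^] (k mod int m) = x [^] k" for k :: int
  proof -
    have "x [^] k = x [^] (int m * (k div int m) + k mod int m)" by simp
    also have "\<dots> = x [^] (int m * (k div int m)) \<otimes> x [^] (k mod int m)"
      by (rule int_pow_mult) (rule x)
    also have "x [^] (int m * (k div int m)) = (x [^] int m) [^] (k div int m)"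
      using x by (simp add: int_pow_pow)
    also have "x [^] int m = \<one>" using m by (simp add: int_pow_int)
    finally show ?thesis using x by simp
  qed
  then show ?thesis
    using x by (auto intro!: homI simp: int_pow_mult)
qed

lemma (in comm_group) hom_product_group_finprod:
  assumes "\<And>i. i \<in> I \<Longrightarrow> \<phi> i \<in> hom (H i) G"
  shows "(\<lambda>e. \<Otimes>i\<in>I. \<phi> i (e i)) \<in> hom (product_group I H) G"
proof (rule homI)
  have mem: "\<phi> i (e i) \<in> carrier G" if "e \<in> carrier (product_group I H)" "i \<in> I" for e i
    using hom_in_carrier[OF assms[OF that(2)]] that by auto
  show "(\<Otimes>i\<in>I. \<phi> i (e i)) \<in> carrier G" if "e \<in> carrier (product_group I H)" for e
    using mem[OF that] by (intro finprod_closed) simp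
  fix e d assume ed: "e \<in> carrier (product_group I H)" "d \<in> carrier (product_group I H)"
  have "(\<Otimes>i\<in>I. \<phi> i ((e \<otimes>\<^bsub>product_group I H\<^esub> d) i)) = (\<Otimes>i\<in>I. \<phi> i (e i) \<otimes> \<phi> i (d i))"
  proof (rule finprod_cong')
    fix i assume i: "i \<in> I"
    have "e i \<in> carrier (H i)" "d i \<in> carrier (H i)" using ed i by auto
    then show "\<phi> i ((e \<otimes>\<^bsub>product_group I H\<^esub> d) i) = \<phi> i (e i) \<otimes> \<phi> i (d i)"
      using i hom_mult[OF assms[OF i]] by simp
  qed (use mem[OF ed(1)] mem[OF ed(2)] in auto)
  also have "\<dots> = (\<Otimes>i\<in>I. \<phi> i (e i)) \<otimes> (\<Otimes>i\<in>I. \<phi> i (d i))"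
    using mem[OF ed(1)] mem[OF ed(2)] by (intro finprod_multf) auto
  finally show "(\<Otimes>i\<in>I. \<phi> i ((e \<otimes>\<^bsub>product_group I H\<^esub> d) i)) = \<dots>" .
qed

lemma (in comm_group) hom_DirProd_mult:
  assumes "\<phi> \<in> hom A G" "\<psi> \<in> hom B G"
  shows "(\<lambda>(a, b). \<phi> a \<otimes> \<psi> b) \<in> hom (A \<times>\<times> B) G"
proof (rule homI; clarsimp)
  fix a b assume "a \<in> carrier A" "b \<in> carrier B"
  then show "\<phi> a \<otimes> \<psi> b \<in> carrier G"
    using hom_in_carrier[OF assms(1)] hom_in_carrier[OF assms(2)] by simp
next
  fix a b a' b' assume "a \<in> carrier A" "b \<in> carrier B" "a' \<in> carrier A" "b' \<in> carrier B"
  then show "\<phi> (a \<otimes>\<^bsub>A\<^esub> a') \<otimes> \<psi> (b \<otimes>\<^bsub>B\<^esub> b') = \<phi> a \<otimes> \<psi> b \<otimes> (\<phi> a' \<otimes> \<psi> b')"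
    using hom_in_carrier[OF assms(1)] hom_in_carrier[OF assms(2)]
    by (simp add: hom_mult[OF assms(1)] hom_mult[OF assms(2)] m_ac)
qed

lemma (in group) card_eq_kernel_times_image:
  assumes "group H" "\<phi> \<in> hom G H" "finite (carrier G)"
  shows "card (carrier G) = card (kernel G H \<phi>) * card (\<phi> ` carrier G)"
proof -
  interpret h: group_hom G H \<phi>
    using assms is_group by (simp add: group_hom_def group_hom_axioms_def)
  \<comment> \<open>Shrinking the codomain to the image makes \<open>\<phi>\<close> surjective, so
    that the first isomorphism theorem identifies the quotient with the image; the kernel stays the
    same.\<close>
  let ?I = "H\<lparr>carrier := \<phi> ` carrier G\<rparr>"
  interpret I: group ?I
    by (rule subgroup.subgroup_is_group[OF h.img_is_subgroup assms(1)])
  interpret hI: group_hom G ?I \<phi>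
    using assms(2) by unfold_locales (auto simp: hom_def)
  have "kernel G ?I \<phi> = kernel G H \<phi>"
    by (simp add: kernel_def)
  then have "card (rcosets\<^bsub>G\<^esub> (kernel G H \<phi>)) = card (\<phi> ` carrier G)"
    using iso_same_card[OF hI.FactGroup_iso] by (simp add: FactGroup_def)
  then show ?thesis
    using lagrange[OF h.subgroup_kernel] by (simp add: order_def mult.commute)
qed

text \<open>The powers of a generator exhaust the unit group, and a surjection between finite sets
  of equal size is injective.\<close>

lemma (in field) units_of_iso_integer_mod_group:
  assumes fin: "finite (carrier R)"
  shows "units_of R \<cong> integer_mod_group (card (carrier R) - 1)"
proof -
  let ?U = "units_of R" and ?m = "card (carrier R) - 1"
  have U: "?U = mult_of R" by (simp add: mult_of_is_Units)
  interpret U: group ?U by (rule units_group)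
  have cU: "card (carrier ?U) = ?m"
    using order_mult_of[OF fin] by (simp add: U order_def)
  have finU: "finite (carrier ?U)" using fin by (simp add: U)
  have m: "?m > 0" using finU cU U.one_closed by (metis card_gt_0_iff empty_iff)
  obtain a where a: "a \<in> carrier (mult_of R)" and gen: "carrier (mult_of R) = {a [^] i | i::nat. i \<in> UNIV}"
    using finite_field_mult_group_has_gen[OF fin] by blast
  have aU: "a \<in> carrier ?U" using a U by simp
  have am: "a [^]\<^bsub>?U\<^esub> ?m = \<one>\<^bsub>?U\<^esub>"
    using U.pow_order_eq_1[OF aU] cU by (simp add: order_def)
  have hom: "(\<lambda>k::int. a [^]\<^bsub>?U\<^esub> k) \<in> hom (integer_mod_group ?m) ?U"
    by (rule U.hom_integer_mod_group_pow[OF aU m am])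
  have surj: "(\<lambda>k::int. a [^]\<^bsub>?U\<^esub> k) ` carrier (integer_mod_group ?m) = carrier ?U"
  proof
    show "(\<lambda>k::int. a [^]\<^bsub>?U\<^esub> k) ` carrier (integer_mod_group ?m) \<subseteq> carrier ?U"
      using aU by auto
    show "carrier ?U \<subseteq> (\<lambda>k::int. a [^]\<^bsub>?U\<^esub> k) ` carrier (integer_mod_group ?m)"
    proof
      fix y assume "y \<in> carrier ?U"
      then obtain i :: nat where y: "y = a [^] i" using gen U by auto
      have "y = a [^]\<^bsub>?U\<^esub> i"
        unfolding y U by (simp add: nat_pow_mult_of)
      \<comment> \<open>The generator theorem yields an arbitrary natural exponent; it has to be
        reduced to a representative in the carrier of \<open>integer_mod_group\<close>.\<close>
      also have "\<dots> = a [^]\<^bsub>?U\<^esub> (i mod ?m)"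
      proof -
        have "a [^]\<^bsub>?U\<^esub> i = a [^]\<^bsub>?U\<^esub> (?m * (i div ?m) + i mod ?m)" by simp
        also have "\<dots> = (a [^]\<^bsub>?U\<^esub> ?m) [^]\<^bsub>?U\<^esub> (i div ?m) \<otimes>\<^bsub>?U\<^esub> a [^]\<^bsub>?U\<^esub> (i mod ?m)"
          using aU by (simp only: U.nat_pow_mult[symmetric] U.nat_pow_pow)
        finally show ?thesis using am aU by simp
      qed
      also have "\<dots> = a [^]\<^bsub>?U\<^esub> int (i mod ?m)" by (simp add: int_pow_int)
      finally show "y \<in> (\<lambda>k::int. a [^]\<^bsub>?U\<^esub> k) ` carrier (integer_mod_group ?m)"
      proof
        have "int (i mod ?m) < int ?m" using m by (simp only: of_nat_less_iff mod_less_divisor)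
        then show "int (i mod ?m) \<in> carrier (integer_mod_group ?m)"
          using m by (simp only: carrier_integer_mod_group) auto
      qed
    qed
  qed
  have "inj_on (\<lambda>k::int. a [^]\<^bsub>?U\<^esub> k) (carrier (integer_mod_group ?m))"
  proof (rule eq_card_imp_inj_on)
    show "finite (carrier (integer_mod_group ?m))"
      using m by (simp only: carrier_integer_mod_group) auto
    have "card (carrier (integer_mod_group ?m)) = ?m"
      using m by (simp only: carrier_integer_mod_group) auto
    then show "card ((\<lambda>k::int. a [^]\<^bsub>?U\<^esub> k) ` carrier (integer_mod_group ?m)) =
        card (carrier (integer_mod_group ?m))"
      by (simp only: surj cU)
  qed
  then have "(\<lambda>k::int. a [^]\<^bsub>?U\<^esub> k) \<in> iso (integer_mod_group ?m) ?U"
    using hom surj by (auto simp: iso_def bij_betw_def)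
  then show ?thesis
    by (intro group.iso_sym[OF group_integer_mod_group] is_isoI)
qed

text \<open>Greedy choice: as long as \<open>B\<close> is not everything, adjoining an element outside \<open>B\<close>, whose square
  lies in \<open>B\<close>, doubles its size.\<close>

lemma (in comm_group) exists_generators_modulo:
  assumes "subgroup E G" "subgroup B G" "B \<subseteq> E" "finite E" "card E = card B * 2 ^ k"
    and sq: "\<And>x. x \<in> E \<Longrightarrow> x \<otimes> x \<in> B"
  shows "\<exists>v. v \<in> {..<k} \<rightarrow> E \<and> (\<forall>x\<in>E. \<exists>b\<in>B. \<exists>S\<subseteq>{..<k}. x = b \<otimes> finprod G v S)"
  using assms(2,3,5,6)
proof (induction k arbitrary: B)
  case 0
  then have "B = E" using \<open>finite E\<close> by (intro card_subset_eq) auto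
  moreover have "x = x \<otimes> finprod G undefined {}" if "x \<in> E" for x
    using that subgroup.mem_carrier[OF assms(1)] by simp
  ultimately show ?case by auto
next
  case (Suc k)
  interpret E: subgroup E G by fact
  interpret B: subgroup B G by fact
  have "finite B" using Suc.prems \<open>finite E\<close> by (auto intro: finite_subset)
  have "B \<noteq> {}" using B.one_closed by blast
  then have "card B > 0" using \<open>finite B\<close> by (simp add: card_gt_0_iff)
  then have "B \<noteq> E" using Suc.prems(3) by auto
  then obtain w where w: "w \<in> E" "w \<notin> B" using Suc.prems by auto
  have wG: "w \<in> carrier G" using w by auto
  have ww: "w \<otimes> w \<in> B" by (rule Suc.prems) (rule w)
  let ?wB = "(\<lambda>b. w \<otimes> b) ` B"
  let ?B' = "B \<union> ?wB"
  \<comment> \<open>The coset of w is closed under inversion because w^-1 b = w (w w)^-1 b, and w w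
    lies in \<open>B\<close>.\<close>
  have wB_inv: "inv w \<otimes> b \<in> ?wB" if "b \<in> B" for b
  proof
    show "inv w \<otimes> b = w \<otimes> (inv (w \<otimes> w) \<otimes> b)"
      using that wG by (simp add: inv_mult_group m_assoc[symmetric])
    show "inv (w \<otimes> w) \<otimes> b \<in> B" using that ww by simp
  qed
  have disj: "B \<inter> ?wB = {}"
  proof (rule ccontr)
    assume "B \<inter> ?wB \<noteq> {}"
    then obtain b where "b \<in> B" "w \<otimes> b \<in> B" by auto
    then have "(w \<otimes> b) \<otimes> inv b \<in> B" by simp
    then show False using w wG \<open>b \<in> B\<close> by (simp add: m_assoc)
  qed
  have card_wB: "card ?wB = card B"
    by (rule card_image) (use wG in \<open>auto simp: inj_on_def\<close>)
  have sub': "subgroup ?B' G"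
  proof (rule subgroupI)
    show "?B' \<subseteq> carrier G" using wG by auto
    show "?B' \<noteq> {}" using B.one_closed by blast
  next
    fix x assume "x \<in> ?B'"
    then show "inv x \<in> ?B'"
      using wG wB_inv by (auto simp: inv_mult)
  next
    fix x y assume "x \<in> ?B'" "y \<in> ?B'"
    then consider "x \<in> B" "y \<in> B" | b where "x \<in> B" "y = w \<otimes> b" "b \<in> B"
      | b where "y \<in> B" "x = w \<otimes> b" "b \<in> B"
      | b c where "x = w \<otimes> b" "b \<in> B" "y = w \<otimes> c" "c \<in> B" by auto
    then show "x \<otimes> y \<in> ?B'"
    proof cases
      case 2
      then have "x \<otimes> y = w \<otimes> (x \<otimes> b)" using wG by (auto simp: m_ac)
      with 2 show ?thesis by auto
    next
      case 3
      then have "x \<otimes> y = w \<otimes> (b \<otimes> y)" using wG by (auto simp: m_ac)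
      with 3 show ?thesis by auto
    next
      case 4
      then have "x \<otimes> y = (w \<otimes> w) \<otimes> (b \<otimes> c)" using wG by (auto simp: m_ac)
      with 4 ww show ?thesis by auto
    qed auto
  qed
  have "card ?B' = 2 * card B"
    using card_Un_disjoint[OF \<open>finite B\<close> _ disj] \<open>finite B\<close> card_wB by simp
  then have card': "card E = card ?B' * 2 ^ k" using Suc.prems by simp
  have "?B' \<subseteq> E" using w Suc.prems(2) by auto
  then have "\<exists>v. v \<in> {..<k} \<rightarrow> E \<and> (\<forall>x\<in>E. \<exists>b\<in>?B'. \<exists>S\<subseteq>{..<k}. x = b \<otimes> finprod G v S)"
    by (rule Suc.IH[OF sub' _ card']) (use Suc.prems(4) in simp)
  then obtain v where v: "v \<in> {..<k} \<rightarrow> E"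
    and span: "\<forall>x\<in>E. \<exists>b\<in>?B'. \<exists>S\<subseteq>{..<k}. x = b \<otimes> finprod G v S"
    by (elim exE conjE)
  let ?v = "v(k := w)"
  have fp: "finprod G ?v S = finprod G v S" "finprod G v S \<in> carrier G" "finite S"
      "finprod G ?v (insert k S) = w \<otimes> finprod G v S" if "S \<subseteq> {..<k}" for S
  proof -
    show "finite S" using that by (auto intro: finite_subset)
    have vS: "v \<in> S \<rightarrow> carrier G" using that E.subset funcset_mem[OF v] by (intro funcsetI) blast
    then show "finprod G v S \<in> carrier G" by simp
    show 1: "finprod G ?v S = finprod G v S"
      by (rule finprod_cong') (use that vS in auto)
    have "finprod G ?v (insert k S) = ?v k \<otimes> finprod G ?v S"
      by (rule finprod_insert) (use that vS wG \<open>finite S\<close> in auto)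
    then show "finprod G ?v (insert k S) = w \<otimes> finprod G v S" using 1 by simp
  qed
  have "\<exists>b\<in>B. \<exists>S\<subseteq>{..<Suc k}. x = b \<otimes> finprod G ?v S" if x: "x \<in> E" for x
  proof -
    obtain b S where b: "b \<in> ?B'" and S: "S \<subseteq> {..<k}" and xeq: "x = b \<otimes> finprod G v S"
      using bspec[OF span x] by (elim bexE exE conjE)
    \<comment> \<open>The new generator w received the index k, which no subset of
      \<open>{..<k}\<close> contains. Whether b involves w decides whether k joins the index
      set.\<close>
    from b consider "b \<in> B" | c where "c \<in> B" "b = w \<otimes> c" by auto
    then show ?thesis
    proof cases
      case 1
      moreover have "S \<subseteq> {..<Suc k}" using S by auto
      moreover have "x = b \<otimes> finprod G ?v S" using xeq fp(1)[OF S] by simp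
      ultimately show ?thesis by blast
    next
      case 2
      have "x = c \<otimes> finprod G ?v (insert k S)"
        using xeq fp[OF S] 2 wG by (simp add: m_ac)
      moreover have "insert k S \<subseteq> {..<Suc k}" using S by auto
      ultimately show ?thesis using 2 by blast
    qed
  qed
  moreover have "?v \<in> {..<Suc k} \<rightarrow> E" using v w by (auto simp: less_Suc_eq)
  ultimately show ?case by blast
qed

text \<open>Let S be the squares of V and K the elements of V with square 1, so S lies in K.
  Counting gives |K| = |V| / |S| = |S| \<open>2^k\<close>. Choose generators \<open>u i\<close> of S
  with square roots \<open>v i\<close> in V, and elements \<open>w j\<close> that generate K modulo
  S. Together the \<open>v i\<close> and \<open>w j\<close> generate V: for g in V some product p of
  the \<open>v i\<close> has the same square as g, so g p^-1 lies in K, and its part in S is the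
  square of another product of the \<open>v i\<close>. Hence the evident homomorphism onto G exists,
  and equality of orders makes it injective.\<close>

lemma (in comm_group) iso_of_exponent_4_times_cyclic:
  assumes V: "subgroup V G" "finite V" and V4: "\<And>x. x \<in> V \<Longrightarrow> (x \<otimes> x) \<otimes> (x \<otimes> x) = \<one>"
    and card_sq: "card ((\<lambda>x. x \<otimes> x) ` V) = 2 ^ n" and card_V: "card V = 2 ^ (2 * n + k)"
    and r: "0 < r" and \<theta>: "\<theta> \<in> hom (integer_mod_group r) G"
    and dec: "\<And>x. x \<in> carrier G \<Longrightarrow> \<exists>z\<in>carrier (integer_mod_group r). \<exists>v\<in>V. x = \<theta> z \<otimes> v"
    and card_G: "card (carrier G) = card V * r"
  shows "cyclic_power 4 n \<times>\<times> cyclic_power 2 k \<times>\<times> integer_mod_group r \<cong> G"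
proof -
  interpret V: subgroup V G by fact
  interpret GV: group "G\<lparr>carrier := V\<rparr>" by (rule V.subgroup_is_group[OF is_group])
  let ?sq = "\<lambda>x. x \<otimes> x"
  let ?S = "?sq ` V" and ?K = "{x \<in> V. x \<otimes> x = \<one>}"
  have mult4: "(a \<otimes> b) \<otimes> (a \<otimes> b) = (a \<otimes> a) \<otimes> (b \<otimes> b)" if "a \<in> V" "b \<in> V" for a b
    using that by (simp add: m_ac)
  have inv2: "inv a \<otimes> inv a = inv (a \<otimes> a)" if "a \<in> V" for a
    using that by (simp add: inv_mult)
  have sq_hom: "?sq \<in> hom (G\<lparr>carrier := V\<rparr>) G"
    by (rule homI) (simp_all add: mult4)
  have "kernel (G\<lparr>carrier := V\<rparr>) G ?sq = ?K" by (simp add: kernel_def)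
  then have "card ?K * 2 ^ n = 2 ^ (2 * n + k)"
    using GV.card_eq_kernel_times_image[OF is_group sq_hom] V(2) card_sq card_V by simp
  also have "(2::nat) ^ (2 * n + k) = (2 ^ n * 2 ^ k) * 2 ^ n" by (simp add: mult_2 power_add)
  finally have card_K: "card ?K = card ?S * 2 ^ k" using card_sq by simp
  have S_sub: "subgroup ?S G"
  proof (rule subgroupI)
    show "?S \<noteq> {}" using V.one_closed by blast
    fix a assume "a \<in> ?S"
    then obtain x where x: "x \<in> V" "a = x \<otimes> x" by blast
    then show "inv a \<in> ?S" using inv2[OF x(1)] by (intro image_eqI[of _ _ "inv x"]) auto
    fix b assume "b \<in> ?S"
    then obtain y where y: "y \<in> V" "b = y \<otimes> y" by blast
    show "a \<otimes> b \<in> ?S" using x y mult4[OF x(1) y(1)] by (intro image_eqI[of _ _ "x \<otimes> y"]) auto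
  qed auto
  have K_sub: "subgroup ?K G"
  proof (rule subgroupI)
    have "\<one> \<in> ?K" by simp
    then show "?K \<noteq> {}" by blast
  qed (auto simp: mult4 inv2)
  have S_K: "?S \<subseteq> ?K" using V4 by auto
  have one_sub: "subgroup {\<one>} G" by (rule triv_subgroup)
  have "\<exists>u. u \<in> {..<n} \<rightarrow> ?S \<and> (\<forall>x\<in>?S. \<exists>b\<in>{\<one>}. \<exists>A\<subseteq>{..<n}. x = b \<otimes> finprod G u A)"
  proof (rule exists_generators_modulo[OF S_sub one_sub])
    show "{\<one>} \<subseteq> ?S" using subgroup.one_closed[OF S_sub] by simp
    show "finite ?S" using V(2) by simp
    show "card ?S = card {\<one>} * 2 ^ n" using card_sq by simp
    show "x \<otimes> x \<in> {\<one>}" if "x \<in> ?S" for x using that V4 by auto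
  qed
  then obtain u where u: "u \<in> {..<n} \<rightarrow> ?S"
    and u_span: "\<forall>x\<in>?S. \<exists>b\<in>{\<one>}. \<exists>A\<subseteq>{..<n}. x = b \<otimes> finprod G u A" by (elim exE conjE)
  have "\<exists>w. w \<in> {..<k} \<rightarrow> ?K \<and> (\<forall>x\<in>?K. \<exists>b\<in>?S. \<exists>A\<subseteq>{..<k}. x = b \<otimes> finprod G w A)"
  proof (rule exists_generators_modulo[OF K_sub S_sub S_K _ card_K])
    show "finite ?K" using V(2) by simp
    show "x \<otimes> x \<in> ?S" if "x \<in> ?K" for x using that by blast
  qed
  then obtain w where w: "w \<in> {..<k} \<rightarrow> ?K"
    and w_span: "\<forall>x\<in>?K. \<exists>b\<in>?S. \<exists>A\<subseteq>{..<k}. x = b \<otimes> finprod G w A" by (elim exE conjE)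
  have "\<forall>i\<in>{..<n}. \<exists>v. v \<in> V \<and> u i = v \<otimes> v" using funcset_mem[OF u] by blast
  then obtain v where v: "\<And>i. i < n \<Longrightarrow> v i \<in> V \<and> u i = v i \<otimes> v i" by (metis lessThan_iff)
  have vG: "v i \<in> carrier G" if "i < n" for i using v[OF that] by auto
  have wK: "w i \<in> V" "w i \<otimes> w i = \<one>" if "i < k" for i using funcset_mem[OF w, of i] that by auto
  have wG: "w i \<in> carrier G" if "i < k" for i using wK(1)[OF that] by auto
  let ?\<psi>1 = "\<lambda>e. \<Otimes>i\<in>{..<n}. v i [^] (e i :: int)" and ?\<psi>2 = "\<lambda>e. \<Otimes>i\<in>{..<k}. w i [^] (e i :: int)"
  have hom1: "?\<psi>1 \<in> hom (cyclic_power 4 n) G"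
  proof (rule hom_product_group_finprod)
    fix i assume "i \<in> {..<n}"
    then have "v i \<in> V" using v by simp
    then show "(\<lambda>e::int. v i [^] e) \<in> hom (integer_mod_group 4) G"
      using V4[of "v i"] by (intro hom_integer_mod_group_pow) (simp_all add: numeral_eq_Suc m_assoc)
  qed
  have hom2: "?\<psi>2 \<in> hom (cyclic_power 2 k) G"
  proof (rule hom_product_group_finprod)
    fix i assume "i \<in> {..<k}"
    then show "(\<lambda>e::int. w i [^] e) \<in> hom (integer_mod_group 2) G"
      using wK[of i] by (intro hom_integer_mod_group_pow) (simp_all add: numeral_eq_Suc)
  qed
  let ?C = "cyclic_power 4 n \<times>\<times> cyclic_power 2 k \<times>\<times> integer_mod_group r"
  let ?\<psi>' = "\<lambda>(e, z). ?\<psi>2 e \<otimes> \<theta> z"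
  let ?\<psi> = "\<lambda>(d, ez). ?\<psi>1 d \<otimes> ?\<psi>' ez"
  have hom: "?\<psi> \<in> hom ?C G"
    by (intro hom_DirProd_mult hom1 hom2 \<theta>)
  have power_indicator: "(\<Otimes>i\<in>{..<l}. a i [^] (if i \<in> A then 1 else 0 :: int)) = finprod G a A"
    if "A \<subseteq> {..<l}" "\<And>i. i < l \<Longrightarrow> a i \<in> carrier G" for a A and l :: nat
    using that by (intro finprod_mono_neutral_cong_left[symmetric]) auto
  have onto: "\<exists>y\<in>carrier ?C. x = ?\<psi> y" if x: "x \<in> carrier G" for x
  proof -
    obtain z g where z: "z \<in> carrier (integer_mod_group r)" and g: "g \<in> V" and xz: "x = \<theta> z \<otimes> g"
      using dec[OF x] by blast
    have \<theta>z: "\<theta> z \<in> carrier G" using hom_in_carrier[OF \<theta> z] .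
    \<comment> \<open>The set A selects the roots \<open>v i\<close> whose product p satisfies p p =
      g g.\<close>
    obtain A where A: "A \<subseteq> {..<n}" "g \<otimes> g = finprod G u A"
    proof -
      have "g \<otimes> g \<in> ?S" using g by blast
      from bspec[OF u_span this] obtain A where "A \<subseteq> {..<n}" "g \<otimes> g = \<one> \<otimes> finprod G u A" by blast
      moreover have "finprod G u A \<in> carrier G"
        using calculation(1) v vG by (intro finprod_closed) auto
      ultimately show ?thesis using that by simp
    qed
    let ?p = "finprod G v A"
    have u_sq: "finprod G u B = finprod G v B \<otimes> finprod G v B" if "B \<subseteq> {..<n}" for B
    proof -
      have "finprod G u B = (\<Otimes>i\<in>B. v i \<otimes> v i)"
        using that v vG by (intro finprod_cong') auto
      also have "\<dots> = finprod G v B \<otimes> finprod G v B"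
        using that vG by (intro finprod_multf) auto
      finally show ?thesis .
    qed
    have pV: "finprod G v B \<in> V" if "B \<subseteq> {..<n}" for B
    proof -
      have "finite B" using that by (auto intro: finite_subset)
      then show ?thesis using that
      proof (induction B rule: finite_induct)
        case (insert i B)
        have "finprod G v (insert i B) = v i \<otimes> finprod G v B"
          by (rule finprod_insert) (use insert vG in auto)
        then show ?case using insert v[of i] by auto
      qed simp
    qed
    have p: "?p \<in> V" by (rule pV[OF A(1)])
    \<comment> \<open>Elements with equal squares differ by an element of K.\<close>
    have "g \<otimes> inv ?p \<in> ?K"
      using g p A u_sq[OF A(1)] by (simp add: mult4 inv2)
    from bspec[OF w_span this] obtain b B where b: "b \<in> ?S" and B: "B \<subseteq> {..<k}"
      and eq: "g \<otimes> inv ?p = b \<otimes> finprod G w B" by (elim bexE exE conjE)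
    from bspec[OF u_span b] obtain A' where A': "A' \<subseteq> {..<n}" and bA': "b = \<one> \<otimes> finprod G u A'" by blast
    let ?p' = "finprod G v A'"
    have p': "?p' \<in> V" by (rule pV[OF A'])
    have b': "b = ?p' \<otimes> ?p'" using bA' u_sq[OF A'] p' by simp
    have wB: "finprod G w B \<in> carrier G" using B wG by (intro finprod_closed) auto
    have "g = (g \<otimes> inv ?p) \<otimes> ?p" using g p by (simp add: m_assoc)
    then have g_eq: "g = (?p \<otimes> (?p' \<otimes> ?p')) \<otimes> finprod G w B"
      unfolding eq b' using p p' wB by (simp add: m_ac)
    \<comment> \<open>The exponent of \<open>v i\<close> is 1 if p uses it plus 2 if p' does, since
      p' enters squared. The sum is at most 3 and so is already a representative modulo 4.\<close>
    let ?d = "\<lambda>i\<in>{..<n}. (if i \<in> A then 1 else 0) + ((if i \<in> A' then 1 else 0) + (if i \<in> A' then 1 else 0)) :: int"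
    let ?e = "\<lambda>i\<in>{..<k}. if i \<in> B then 1 else 0 :: int"
    have "?\<psi>1 ?d = (\<Otimes>i\<in>{..<n}. v i [^] (if i \<in> A then 1 else 0 :: int) \<otimes>
        (v i [^] (if i \<in> A' then 1 else 0 :: int) \<otimes> v i [^] (if i \<in> A' then 1 else 0 :: int)))"
      using vG by (intro finprod_cong') (auto simp add: int_pow_mult[symmetric])
    also have "\<dots> = (\<Otimes>i\<in>{..<n}. v i [^] (if i \<in> A then 1 else 0 :: int)) \<otimes>
        ((\<Otimes>i\<in>{..<n}. v i [^] (if i \<in> A' then 1 else 0 :: int)) \<otimes>
         (\<Otimes>i\<in>{..<n}. v i [^] (if i \<in> A' then 1 else 0 :: int)))"
      using vG by (subst finprod_multf; (subst finprod_multf)?) auto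
    also have "\<dots> = ?p \<otimes> (?p' \<otimes> ?p')"
      using A(1) A' vG by (simp only: power_indicator)
    finally have \<psi>1: "?\<psi>1 ?d = ?p \<otimes> (?p' \<otimes> ?p')" .
    have "?\<psi>2 ?e = (\<Otimes>i\<in>{..<k}. w i [^] (if i \<in> B then 1 else 0 :: int))"
      using wG by (intro finprod_cong') auto
    also have "\<dots> = finprod G w B" using B wG by (simp only: power_indicator)
    finally have \<psi>2: "?\<psi>2 ?e = finprod G w B" .
    have "?\<psi> (?d, (?e, z)) = ?p \<otimes> (?p' \<otimes> ?p') \<otimes> (finprod G w B \<otimes> \<theta> z)"
      by (simp only: prod.case \<psi>1 \<psi>2)
    also have "\<dots> = x"
      unfolding xz g_eq using p p' wB \<theta>z by (simp add: m_ac)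
    finally have "x = ?\<psi> (?d, (?e, z))" by simp
    moreover have "(?d, (?e, z)) \<in> carrier ?C"
      using z by (auto simp: carrier_integer_mod_group)
    ultimately show ?thesis by blast
  qed
  have img: "?\<psi> ` carrier ?C = carrier G"
  proof
    show "?\<psi> ` carrier ?C \<subseteq> carrier G" using hom_in_carrier[OF hom] by blast
    show "carrier G \<subseteq> ?\<psi> ` carrier ?C" using onto by blast
  qed
  \<comment> \<open>Surjectivity is known, so it suffices that the product has order
    \<open>4^n * 2^k * r\<close>, which is |V| r.\<close>
  have "inj_on ?\<psi> (carrier ?C)"
  proof (rule eq_card_imp_inj_on)
    show "finite (carrier ?C)"
      using r by (auto simp: carrier_integer_mod_group intro!: finite_PiE)
    have "card (carrier ?C) = 4 ^ n * (2 ^ k * r)"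
      using r by (simp add: carrier_integer_mod_group card_cartesian_product card_PiE)
    also have "\<dots> = card V * r" by (simp add: card_V power_add power_mult)
    finally show "card (?\<psi> ` carrier ?C) = card (carrier ?C)"
      by (simp only: img card_G)
  qed
  then have "?\<psi> \<in> iso ?C G" using hom img by (simp add: iso_def bij_betw_def)
  then show ?thesis by (rule is_isoI)
qed

section \<open>Fourier transform\<close>

text \<open>Via \<open>b\<close> each g becomes a character of \<open>G\<close> with values in
  \<open>S\<close>. The ring \<open>S\<close> may be larger than the coefficient ring, as needed
  when -1 is not a square in the field. Nondegeneracy serves orthogonality; the last assumption lets
  the factor |G| be cancelled after inversion.\<close>

locale nondegenerate_pairing = finite_group_algebra R G + S: domain S
  for R (structure) and G (structure) and S (structure) +
  fixes \<iota> and b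
  assumes \<iota>_hom: "\<iota> \<in> ring_hom R S" and \<iota>_inj: "inj_on \<iota> (carrier R)"
    and b_closed [simp]: "\<And>g h. g \<in> carrier G \<Longrightarrow> h \<in> carrier G \<Longrightarrow> b g h \<in> carrier S"
    and b_mult_left: "\<And>g g' h. g \<in> carrier G \<Longrightarrow> g' \<in> carrier G \<Longrightarrow> h \<in> carrier G \<Longrightarrow>
      b (g \<otimes>\<^bsub>G\<^esub> g') h = b g h \<otimes>\<^bsub>S\<^esub> b g' h"
    and b_mult_right: "\<And>g h h'. g \<in> carrier G \<Longrightarrow> h \<in> carrier G \<Longrightarrow> h' \<in> carrier G \<Longrightarrow>
      b g (h \<otimes>\<^bsub>G\<^esub> h') = b g h \<otimes>\<^bsub>S\<^esub> b g h'"
    and b_one_right: "\<And>g. g \<in> carrier G \<Longrightarrow> b g \<one>\<^bsub>G\<^esub> = \<one>\<^bsub>S\<^esub>"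
    and b_nondegenerate: "\<And>h. h \<in> carrier G \<Longrightarrow> h \<noteq> \<one>\<^bsub>G\<^esub> \<Longrightarrow> \<exists>g\<in>carrier G. b g h \<noteq> \<one>\<^bsub>S\<^esub>"
    and card_G_nonzero: "[card (carrier G)] \<cdot>\<^bsub>S\<^esub> \<one>\<^bsub>S\<^esub> \<noteq> \<zero>\<^bsub>S\<^esub>"
begin

abbreviation transform where "transform g \<equiv> character_sum S G \<iota> (b g)"

text \<open>For h other than 1 choose g0 with \<open>b g0 h\<close> different from 1. Translation by
  g0 multiplies the sum by \<open>b g0 h\<close>, and in a domain this forces the sum to
  vanish.\<close>

lemma orthogonality:
  assumes h: "h \<in> carrier G"
  shows "(\<Oplus>\<^bsub>S\<^esub>g\<in>carrier G. b g h) = (if h = \<one>\<^bsub>G\<^esub> then [card (carrier G)] \<cdot>\<^bsub>S\<^esub> \<one>\<^bsub>S\<^esub> else \<zero>\<^bsub>S\<^esub>)"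
proof (cases "h = \<one>\<^bsub>G\<^esub>")
  case True
  have "(\<Oplus>\<^bsub>S\<^esub>g\<in>carrier G. b g h) = (\<Oplus>\<^bsub>S\<^esub>g\<in>carrier G. \<one>\<^bsub>S\<^esub>)"
    by (rule S.finsum_cong') (auto simp: True b_one_right)
  with True show ?thesis by (simp add: S.add.finprod_const add_pow_def)
next
  case False
  then obtain g0 where g0: "g0 \<in> carrier G" "b g0 h \<noteq> \<one>\<^bsub>S\<^esub>" using b_nondegenerate h by blast
  let ?s = "\<Oplus>\<^bsub>S\<^esub>g\<in>carrier G. b g h"
  have s: "?s \<in> carrier S" using h by (intro S.finsum_closed) auto
  have "?s = (\<Oplus>\<^bsub>S\<^esub>g\<in>carrier G. b (g0 \<otimes>\<^bsub>G\<^esub> g) h)"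
    by (rule S.finsum_bij[OF bij_translate[OF g0(1)]]) (use h in auto)
  also have "\<dots> = (\<Oplus>\<^bsub>S\<^esub>g\<in>carrier G. b g0 h \<otimes>\<^bsub>S\<^esub> b g h)"
    by (rule S.finsum_cong') (use h g0 b_mult_left in auto)
  also have "\<dots> = b g0 h \<otimes>\<^bsub>S\<^esub> ?s"
    using h g0 finite_G by (intro S.finsum_rdistr [symmetric]) auto
  finally have eq: "?s = b g0 h \<otimes>\<^bsub>S\<^esub> ?s" .
  have "?s = \<zero>\<^bsub>S\<^esub>"
  proof (rule ccontr)
    assume nz: "?s \<noteq> \<zero>\<^bsub>S\<^esub>"
    have "\<one>\<^bsub>S\<^esub> \<otimes>\<^bsub>S\<^esub> ?s = b g0 h \<otimes>\<^bsub>S\<^esub> ?s" using eq s by simp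
    then have "\<one>\<^bsub>S\<^esub> = b g0 h"
      using S.m_rcancel[OF nz s, of "\<one>\<^bsub>S\<^esub>" "b g0 h"] g0(1) h by simp
    with g0 show False by simp
  qed
  with False show ?thesis by simp
qed

lemma transform_closed [simp]:
  "f \<in> carrier RG \<Longrightarrow> g \<in> carrier G \<Longrightarrow> transform g f \<in> carrier S"
  by (rule character_sum_closed) (auto simp: \<iota>_hom S.is_cring)

lemma transform_mult:
  "f \<in> carrier RG \<Longrightarrow> h \<in> carrier RG \<Longrightarrow> g \<in> carrier G \<Longrightarrow>
    transform g (f \<otimes>\<^bsub>RG\<^esub> h) = transform g f \<otimes>\<^bsub>S\<^esub> transform g h"
  by (rule character_sum_mult) (auto simp: \<iota>_hom S.is_cring b_mult_right)

lemma transform_one: "g \<in> carrier G \<Longrightarrow> transform g \<one>\<^bsub>RG\<^esub> = \<one>\<^bsub>S\<^esub>"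
  by (rule character_sum_one) (auto simp: \<iota>_hom S.is_cring b_one_right)

text \<open>After the sums are exchanged, summing b(g, x h^-1) over g leaves only the term x = h.
  The factor |G| is kept on the right because \<open>S\<close> is only a domain.\<close>

lemma inversion:
  assumes f: "f \<in> carrier RG" and h: "h \<in> carrier G"
  shows "(\<Oplus>\<^bsub>S\<^esub>g\<in>carrier G. transform g f \<otimes>\<^bsub>S\<^esub> b g (inv\<^bsub>G\<^esub> h)) =
    \<iota> (f h) \<otimes>\<^bsub>S\<^esub> [card (carrier G)] \<cdot>\<^bsub>S\<^esub> \<one>\<^bsub>S\<^esub>"
proof -
  have \<iota>f: "\<iota> (f x) \<in> carrier S" if "x \<in> carrier G" for x
    using ring_hom_closed[OF \<iota>_hom] f that by simp
  have "(\<Oplus>\<^bsub>S\<^esub>g\<in>carrier G. transform g f \<otimes>\<^bsub>S\<^esub> b g (inv\<^bsub>G\<^esub> h)) =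
      (\<Oplus>\<^bsub>S\<^esub>g\<in>carrier G. \<Oplus>\<^bsub>S\<^esub>x\<in>carrier G. \<iota> (f x) \<otimes>\<^bsub>S\<^esub> b g (x \<otimes>\<^bsub>G\<^esub> inv\<^bsub>G\<^esub> h))"
  proof (rule S.finsum_cong')
    fix g assume g: "g \<in> carrier G"
    have "transform g f \<otimes>\<^bsub>S\<^esub> b g (inv\<^bsub>G\<^esub> h)
        = (\<Oplus>\<^bsub>S\<^esub>x\<in>carrier G. (\<iota> (f x) \<otimes>\<^bsub>S\<^esub> b g x) \<otimes>\<^bsub>S\<^esub> b g (inv\<^bsub>G\<^esub> h))"
      unfolding character_sum_def using g h \<iota>f finite_G by (intro S.finsum_ldistr) auto
    also have "\<dots> = (\<Oplus>\<^bsub>S\<^esub>x\<in>carrier G. \<iota> (f x) \<otimes>\<^bsub>S\<^esub> b g (x \<otimes>\<^bsub>G\<^esub> inv\<^bsub>G\<^esub> h))"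
      using g h \<iota>f by (intro S.finsum_cong') (auto simp: S.m_assoc b_mult_right)
    finally show "transform g f \<otimes>\<^bsub>S\<^esub> b g (inv\<^bsub>G\<^esub> h) = \<dots>" .
  qed (use h \<iota>f in auto)
  also have "\<dots> = (\<Oplus>\<^bsub>S\<^esub>x\<in>carrier G. \<Oplus>\<^bsub>S\<^esub>g\<in>carrier G. \<iota> (f x) \<otimes>\<^bsub>S\<^esub> b g (x \<otimes>\<^bsub>G\<^esub> inv\<^bsub>G\<^esub> h))"
    by (rule S.finsum_swap) (use h \<iota>f finite_G in auto)
  also have "\<dots> = (\<Oplus>\<^bsub>S\<^esub>x\<in>carrier G. if x = h then \<iota> (f x) \<otimes>\<^bsub>S\<^esub> [card (carrier G)] \<cdot>\<^bsub>S\<^esub> \<one>\<^bsub>S\<^esub> else \<zero>\<^bsub>S\<^esub>)"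
  proof (rule S.finsum_cong')
    fix x assume x: "x \<in> carrier G"
    have xh: "x \<otimes>\<^bsub>G\<^esub> inv\<^bsub>G\<^esub> h = \<one>\<^bsub>G\<^esub> \<longleftrightarrow> x = h"
      using x h by (metis G.inv_closed G.inv_equality G.inv_inv G.r_inv)
    have "(\<Oplus>\<^bsub>S\<^esub>g\<in>carrier G. \<iota> (f x) \<otimes>\<^bsub>S\<^esub> b g (x \<otimes>\<^bsub>G\<^esub> inv\<^bsub>G\<^esub> h))
        = \<iota> (f x) \<otimes>\<^bsub>S\<^esub> (\<Oplus>\<^bsub>S\<^esub>g\<in>carrier G. b g (x \<otimes>\<^bsub>G\<^esub> inv\<^bsub>G\<^esub> h))"
      using x h \<iota>f finite_G by (intro S.finsum_rdistr [symmetric]) auto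
    then show "(\<Oplus>\<^bsub>S\<^esub>g\<in>carrier G. \<iota> (f x) \<otimes>\<^bsub>S\<^esub> b g (x \<otimes>\<^bsub>G\<^esub> inv\<^bsub>G\<^esub> h))
        = (if x = h then \<iota> (f x) \<otimes>\<^bsub>S\<^esub> [card (carrier G)] \<cdot>\<^bsub>S\<^esub> \<one>\<^bsub>S\<^esub> else \<zero>\<^bsub>S\<^esub>)"
      using x h \<iota>f by (simp add: orthogonality xh)
  qed (use \<iota>f in auto)
  also have "\<dots> = \<iota> (f h) \<otimes>\<^bsub>S\<^esub> [card (carrier G)] \<cdot>\<^bsub>S\<^esub> \<one>\<^bsub>S\<^esub>"
    by (rule S.add.finprod_singleton_swap) (use h \<iota>f finite_G in auto)
  finally show ?thesis .
qed

lemma transform_inj: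
  assumes f: "f \<in> carrier RG" and f': "f' \<in> carrier RG"
    and eq: "\<And>g. g \<in> carrier G \<Longrightarrow> transform g f = transform g f'"
  shows "f = f'"
proof (rule RG_eqI[OF f f'])
  fix h assume h: "h \<in> carrier G"
  have "(\<Oplus>\<^bsub>S\<^esub>g\<in>carrier G. transform g f \<otimes>\<^bsub>S\<^esub> b g (inv\<^bsub>G\<^esub> h)) =
      (\<Oplus>\<^bsub>S\<^esub>g\<in>carrier G. transform g f' \<otimes>\<^bsub>S\<^esub> b g (inv\<^bsub>G\<^esub> h))"
    by (rule S.finsum_cong') (use f' h eq in auto)
  then have "\<iota> (f h) \<otimes>\<^bsub>S\<^esub> [card (carrier G)] \<cdot>\<^bsub>S\<^esub> \<one>\<^bsub>S\<^esub> = \<iota> (f' h) \<otimes>\<^bsub>S\<^esub> [card (carrier G)] \<cdot>\<^bsub>S\<^esub> \<one>\<^bsub>S\<^esub>"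
    using f f' h by (simp add: inversion)
  then have "\<iota> (f h) = \<iota> (f' h)"
    using S.m_rcancel[OF card_G_nonzero] f f' h ring_hom_closed[OF \<iota>_hom] by simp
  then show "f h = f' h"
    using inj_onD[OF \<iota>_inj] f f' h by simp
qed

end

lemma bij_betw_of_inj_on_card:
  assumes "inj_on \<phi> A" "\<phi> \<in> A \<rightarrow> B" "finite B" "card A = card B"
  shows "bij_betw \<phi> A B"
  using assms card_image[OF assms(1)] card_subset_eq[OF assms(3), of "\<phi> ` A"]
  by (auto simp: bij_betw_def)

lemma (in finite_group_algebra) card_RG:
  "finite (carrier R) \<Longrightarrow> card (carrier RG) = card (carrier R) ^ card (carrier G)"
  by (simp add: carrier_RG card_PiE finite_G)

lemma units_group_algebra_split:
  assumes "nondegenerate_pairing R G R id b" "finite (carrier R)"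
  shows "units_of (group_algebra R G) \<cong> product_group (carrier G) (\<lambda>_. units_of R)"
proof -
  interpret nondegenerate_pairing R G R id b by fact
  let ?\<phi> = "\<lambda>f. \<lambda>g\<in>carrier G. transform g f"
  interpret RG: comm_monoid RG by (rule RG_comm_monoid)
  have hom: "?\<phi> \<in> hom RG (product_group (carrier G) (\<lambda>_. R))"
    by (rule homI) (auto simp: transform_mult intro!: restrict_ext)
  have one: "?\<phi> \<one>\<^bsub>RG\<^esub> = \<one>\<^bsub>product_group (carrier G) (\<lambda>_. R)\<^esub>"
    by (auto simp: transform_one intro!: restrict_ext)
  have "inj_on ?\<phi> (carrier RG)"
    by (rule inj_onI) (metis (no_types, lifting) restrict_apply' transform_inj)
  then have "bij_betw ?\<phi> (carrier RG) (carrier (product_group (carrier G) (\<lambda>_. R)))"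
    by (rule bij_betw_of_inj_on_card)
       (use assms(2) finite_G in \<open>auto simp: card_RG card_PiE intro!: finite_PiE\<close>)
  from units_of_iso[OF hom one this RG.monoid_axioms] show ?thesis
    by (simp add: units_of_product_group)
qed

text \<open>The pair (a, b) stands for a + b i with i i = -1, so this is R[X]/(X^2 + 1) in the basis
  1, i.\<close>

definition adjoin_i :: "('a, 'b) ring_scheme \<Rightarrow> ('a \<times> 'a) ring" where
  "adjoin_i R = \<lparr>carrier = carrier R \<times> carrier R,
     monoid.mult = (\<lambda>(a, b) (c, d). (a \<otimes>\<^bsub>R\<^esub> c \<ominus>\<^bsub>R\<^esub> b \<otimes>\<^bsub>R\<^esub> d, a \<otimes>\<^bsub>R\<^esub> d \<oplus>\<^bsub>R\<^esub> b \<otimes>\<^bsub>R\<^esub> c)),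
     one = (\<one>\<^bsub>R\<^esub>, \<zero>\<^bsub>R\<^esub>), zero = (\<zero>\<^bsub>R\<^esub>, \<zero>\<^bsub>R\<^esub>),
     add = (\<lambda>(a, b) (c, d). (a \<oplus>\<^bsub>R\<^esub> c, b \<oplus>\<^bsub>R\<^esub> d))\<rparr>"

lemma adjoin_i_simps [simp]:
  "carrier (adjoin_i R) = carrier R \<times> carrier R"
  "(a, b) \<otimes>\<^bsub>adjoin_i R\<^esub> (c, d) = (a \<otimes>\<^bsub>R\<^esub> c \<ominus>\<^bsub>R\<^esub> b \<otimes>\<^bsub>R\<^esub> d, a \<otimes>\<^bsub>R\<^esub> d \<oplus>\<^bsub>R\<^esub> b \<otimes>\<^bsub>R\<^esub> c)"
  "\<one>\<^bsub>adjoin_i R\<^esub> = (\<one>\<^bsub>R\<^esub>, \<zero>\<^bsub>R\<^esub>)"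
  "\<zero>\<^bsub>adjoin_i R\<^esub> = (\<zero>\<^bsub>R\<^esub>, \<zero>\<^bsub>R\<^esub>)"
  "(a, b) \<oplus>\<^bsub>adjoin_i R\<^esub> (c, d) = (a \<oplus>\<^bsub>R\<^esub> c, b \<oplus>\<^bsub>R\<^esub> d)"
  by (simp_all add: adjoin_i_def)

context cring
begin

lemma adjoin_i_cring: "cring (adjoin_i R)"
proof (rule cringI)
  show "abelian_group (adjoin_i R)"
  proof (rule abelian_groupI)
    fix x assume "x \<in> carrier (adjoin_i R)"
    then show "\<exists>y\<in>carrier (adjoin_i R). y \<oplus>\<^bsub>adjoin_i R\<^esub> x = \<zero>\<^bsub>adjoin_i R\<^esub>"
      by (intro bexI[of _ "(\<ominus> fst x, \<ominus> snd x)"]) (auto simp: l_neg)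
  qed (auto simp: a_ac)
  show "Group.comm_monoid (adjoin_i R)"
  proof (rule comm_monoidI)
    fix x y z assume "x \<in> carrier (adjoin_i R)" "y \<in> carrier (adjoin_i R)" "z \<in> carrier (adjoin_i R)"
    then show "x \<otimes>\<^bsub>adjoin_i R\<^esub> y \<otimes>\<^bsub>adjoin_i R\<^esub> z = x \<otimes>\<^bsub>adjoin_i R\<^esub> (y \<otimes>\<^bsub>adjoin_i R\<^esub> z)"
      by (cases x; cases y; cases z; simp) (intro conjI; algebra)
  next
    fix x y assume "x \<in> carrier (adjoin_i R)" "y \<in> carrier (adjoin_i R)"
    then show "x \<otimes>\<^bsub>adjoin_i R\<^esub> y = y \<otimes>\<^bsub>adjoin_i R\<^esub> x"
      by (cases x; cases y; simp) (intro conjI; algebra)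
  next
    fix x assume "x \<in> carrier (adjoin_i R)"
    then show "\<one>\<^bsub>adjoin_i R\<^esub> \<otimes>\<^bsub>adjoin_i R\<^esub> x = x"
      by (cases x) (simp add: minus_eq)
  qed auto
  fix x y z assume "x \<in> carrier (adjoin_i R)" "y \<in> carrier (adjoin_i R)" "z \<in> carrier (adjoin_i R)"
  then show "(x \<oplus>\<^bsub>adjoin_i R\<^esub> y) \<otimes>\<^bsub>adjoin_i R\<^esub> z
      = x \<otimes>\<^bsub>adjoin_i R\<^esub> z \<oplus>\<^bsub>adjoin_i R\<^esub> y \<otimes>\<^bsub>adjoin_i R\<^esub> z"
    by (cases x; cases y; cases z; simp) (intro conjI; algebra)
qed

lemma adjoin_i_embedding: "(\<lambda>a. (a, \<zero>)) \<in> ring_hom R (adjoin_i R)"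
  by (rule ring_hom_memI) (auto simp: minus_eq)

lemma adjoin_i_conj: "(\<lambda>(a, b). (a, \<ominus> b)) \<in> ring_hom (adjoin_i R) (adjoin_i R)"
proof (rule ring_hom_memI)
  fix x y assume "x \<in> carrier (adjoin_i R)" "y \<in> carrier (adjoin_i R)"
  then show "(case x \<otimes>\<^bsub>adjoin_i R\<^esub> y of (a, b) \<Rightarrow> (a, \<ominus> b)) =
      (case x of (a, b) \<Rightarrow> (a, \<ominus> b)) \<otimes>\<^bsub>adjoin_i R\<^esub> (case y of (a, b) \<Rightarrow> (a, \<ominus> b))"
    by (cases x; cases y; simp) (intro conjI; algebra)
next
  fix x y assume "x \<in> carrier (adjoin_i R)" "y \<in> carrier (adjoin_i R)"
  then show "(case x \<oplus>\<^bsub>adjoin_i R\<^esub> y of (a, b) \<Rightarrow> (a, \<ominus> b)) =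
      (case x of (a, b) \<Rightarrow> (a, \<ominus> b)) \<oplus>\<^bsub>adjoin_i R\<^esub> (case y of (a, b) \<Rightarrow> (a, \<ominus> b))"
    by (cases x; cases y; simp) algebra
qed auto

end

text \<open>The inverse of a + b i is (a - b i) / (a^2 + b^2). If the norm a^2 + b^2 vanished with b
  nonzero, a / b would be a square root of -1; if b = 0, then a would vanish too.\<close>

lemma (in field) adjoin_i_field:
  assumes no_root: "\<And>x. x \<in> carrier R \<Longrightarrow> x \<otimes> x \<noteq> \<ominus> \<one>"
  shows "field (adjoin_i R)"
proof (rule cring.cring_fieldI2[OF adjoin_i_cring])
  show "\<zero>\<^bsub>adjoin_i R\<^esub> \<noteq> \<one>\<^bsub>adjoin_i R\<^esub>" by simp
  fix x assume "x \<in> carrier (adjoin_i R)" "x \<noteq> \<zero>\<^bsub>adjoin_i R\<^esub>"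
  then obtain a b where x: "x = (a, b)" and ab: "a \<in> carrier R" "b \<in> carrier R" and nz: "a \<noteq> \<zero> \<or> b \<noteq> \<zero>"
    by (cases x) auto
  let ?N = "a \<otimes> a \<oplus> b \<otimes> b"
  have "?N \<noteq> \<zero>"
  proof
    assume N: "?N = \<zero>"
    show False
    proof (cases "b = \<zero>")
      case True
      with N ab have "a \<otimes> a = \<zero>" by simp
      then have "a = \<zero>" using ab integral by blast
      with True nz show False by simp
    next
      case False
      then obtain c where c: "c \<in> carrier R" "b \<otimes> c = \<one>"
        using ab field_Units Units_inv_closed Units_r_inv by (metis DiffI singletonD)
      have "(a \<otimes> c) \<otimes> (a \<otimes> c) = ?N \<otimes> (c \<otimes> c) \<ominus> (b \<otimes> c) \<otimes> (b \<otimes> c)"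
        using ab c(1) by algebra
      also have "\<dots> = \<ominus> \<one>" using N c by (simp add: minus_eq)
      finally show False using no_root[of "a \<otimes> c"] ab c by simp
    qed
  qed
  then obtain c where c: "c \<in> carrier R" "?N \<otimes> c = \<one>"
    using ab field_Units Units_inv_closed Units_r_inv by (metis DiffI a_closed m_closed singletonD)
  have "a \<otimes> (a \<otimes> c) \<ominus> b \<otimes> (\<ominus> (b \<otimes> c)) = ?N \<otimes> c"
    using ab c(1) by algebra
  moreover have "a \<otimes> (\<ominus> (b \<otimes> c)) \<oplus> b \<otimes> (a \<otimes> c) = \<zero>"
    using ab c(1) by algebra
  ultimately have "x \<otimes>\<^bsub>adjoin_i R\<^esub> (a \<otimes> c, \<ominus> (b \<otimes> c)) = (?N \<otimes> c, \<zero>)"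
    by (simp add: x)
  with c ab show "\<exists>y\<in>carrier (adjoin_i R). x \<otimes>\<^bsub>adjoin_i R\<^esub> y = \<one>\<^bsub>adjoin_i R\<^esub>"
    by (intro bexI[of _ "(a \<otimes> c, \<ominus> (b \<otimes> c))"]) auto
qed

text \<open>When the values of the pairing lie in \<open>R[i]\<close>, conjugation exchanges the values of a transform at
  \<open>g\<close> and \<open>g\<inverse>\<close>; so the value is real when \<open>g\<close> is its own inverse, and only one of \<open>g\<close>, \<open>g\<inverse>\<close>
  matters otherwise.\<close>

lemma units_group_algebra_split_conj:
  fixes R (structure)
  assumes "nondegenerate_pairing R G (adjoin_i R) (\<lambda>a. (a, \<zero>\<^bsub>R\<^esub>)) b" "finite (carrier R)"
    and conj: "\<And>g h. g \<in> carrier G \<Longrightarrow> h \<in> carrier G \<Longrightarrow>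
      b (inv\<^bsub>G\<^esub> g) h = (case b g h of (u, v) \<Rightarrow> (u, \<ominus>\<^bsub>R\<^esub> v))"
    and I: "I \<subseteq> carrier G" "\<And>g. g \<in> I \<Longrightarrow> inv\<^bsub>G\<^esub> g = g" and J: "J \<subseteq> carrier G"
    and IJ: "\<And>g. g \<in> carrier G \<Longrightarrow> g \<in> I \<or> g \<in> J \<or> inv\<^bsub>G\<^esub> g \<in> J"
    and card: "card (carrier G) = card I + 2 * card J"
    and two: "\<one>\<^bsub>R\<^esub> \<oplus>\<^bsub>R\<^esub> \<one>\<^bsub>R\<^esub> \<noteq> \<zero>\<^bsub>R\<^esub>" and R: "domain R"
  shows "units_of (group_algebra R G) \<cong>
    product_group I (\<lambda>_. units_of R) \<times>\<times> product_group J (\<lambda>_. units_of (adjoin_i R))"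
proof -
  interpret nondegenerate_pairing R G "adjoin_i R" "\<lambda>a. (a, \<zero>\<^bsub>R\<^esub>)" b by fact
  interpret R: domain R by fact
  let ?K = "adjoin_i R"
  let ?conj = "\<lambda>(u, v). (u, \<ominus>\<^bsub>R\<^esub> v)"
  interpret conj: ring_hom_cring ?K ?K ?conj
    using adjoin_i_conj by unfold_locales
  let ?\<phi> = "\<lambda>f. (\<lambda>g\<in>I. fst (transform g f), \<lambda>g\<in>J. transform g f)"
  let ?M = "product_group I (\<lambda>_. R) \<times>\<times> product_group J (\<lambda>_. ?K)"
  interpret RG: comm_monoid RG by (rule RG_comm_monoid)
  have fin: "finite I" "finite J" using I J finite_G by (auto intro: finite_subset)
  have conj_transform: "transform (inv\<^bsub>G\<^esub> g) f = ?conj (transform g f)"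
    if g: "g \<in> carrier G" and f: "f \<in> carrier RG" for g f
  proof -
    have mem: "(f x, \<zero>) \<otimes>\<^bsub>?K\<^esub> b g x \<in> carrier ?K" if "x \<in> carrier G" for x
      using b_closed[OF g that] RG_closed[OF f that] by (intro S.m_closed) auto
    have "?conj (transform g f) = (\<Oplus>\<^bsub>?K\<^esub>x\<in>carrier G. ?conj ((f x, \<zero>) \<otimes>\<^bsub>?K\<^esub> b g x))"
      unfolding character_sum_def by (subst conj.hom_finsum) (use mem in \<open>auto simp: o_def\<close>)
    also have "\<dots> = transform (inv\<^bsub>G\<^esub> g) f"
      unfolding character_sum_def
    proof (rule S.finsum_cong')
      fix x assume x: "x \<in> carrier G"
      have "?conj ((f x, \<zero>) \<otimes>\<^bsub>?K\<^esub> b g x) = ?conj (f x, \<zero>) \<otimes>\<^bsub>?K\<^esub> ?conj (b g x)"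
        by (rule conj.hom_mult) (use b_closed[OF g x] RG_closed[OF f x] in auto)
      then show "?conj ((f x, \<zero>) \<otimes>\<^bsub>?K\<^esub> b g x) = (f x, \<zero>) \<otimes>\<^bsub>?K\<^esub> b (inv\<^bsub>G\<^esub> g) x"
        using conj[OF g x] by simp
    next
      show "(\<lambda>x. (f x, \<zero>) \<otimes>\<^bsub>?K\<^esub> b (inv\<^bsub>G\<^esub> g) x) \<in> carrier G \<rightarrow> carrier ?K"
        using g RG_closed[OF f] b_closed[OF G.inv_closed[OF g]] by (intro funcsetI S.m_closed) auto
    qed simp
    finally show ?thesis by simp
  qed
  have real: "transform g f = (fst (transform g f), \<zero>)" if "g \<in> I" "f \<in> carrier RG" for g f
  proof -
    obtain u v where uv: "transform g f = (u, v)" by fastforce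
    have mem: "v \<in> carrier R" using transform_closed[of f g] that I(1) uv by auto
    have "v = \<ominus> v" using conj_transform[of g f] that I uv by auto
    then have "(\<one> \<oplus> \<one>) \<otimes> v = \<zero>" using mem by (metis l_distr l_one one_closed r_neg)
    then have "v = \<zero>" using two mem R.integral by blast
    with uv show ?thesis by simp
  qed
  have fst_closed: "fst (transform g f) \<in> carrier R" if "g \<in> I" "f \<in> carrier RG" for g f
    using transform_closed[OF that(2), of g] that I(1) by (auto simp: mem_Times_iff)
  have J_closed: "transform g f \<in> carrier R \<times> carrier R" if "g \<in> J" "f \<in> carrier RG" for g f
    using transform_closed[OF that(2), of g] that J by auto
  have fst_mult: "fst (transform g (f \<otimes>\<^bsub>RG\<^esub> h)) = fst (transform g f) \<otimes> fst (transform g h)"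
    if "g \<in> I" "f \<in> carrier RG" "h \<in> carrier RG" for g f h
  proof -
    have g: "g \<in> carrier G" using that I by auto
    have "transform g (f \<otimes>\<^bsub>RG\<^esub> h) =
        (fst (transform g f), \<zero>) \<otimes>\<^bsub>?K\<^esub> (fst (transform g h), \<zero>)"
      using transform_mult[OF that(2,3) g] real[OF that(1,2)] real[OF that(1,3)] by simp
    then show ?thesis
      using fst_closed[OF that(1,2)] fst_closed[OF that(1,3)] by (simp add: minus_eq)
  qed
  have hom: "?\<phi> \<in> hom RG ?M"
  proof (rule homI)
    fix f assume "f \<in> carrier RG"
    then show "?\<phi> f \<in> carrier ?M" using fst_closed J_closed by auto
  next
    fix f h assume "f \<in> carrier RG" "h \<in> carrier RG"
    then show "?\<phi> (f \<otimes>\<^bsub>RG\<^esub> h) = ?\<phi> f \<otimes>\<^bsub>?M\<^esub> ?\<phi> h"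
      using J by (auto simp: fst_mult transform_mult intro!: restrict_ext)
  qed
  have one: "?\<phi> \<one>\<^bsub>RG\<^esub> = \<one>\<^bsub>?M\<^esub>"
    using I J by (auto simp: transform_one intro!: restrict_ext)
  have "inj_on ?\<phi> (carrier RG)"
  proof (rule inj_onI)
    fix f h assume f: "f \<in> carrier RG" and h: "h \<in> carrier RG" and eq: "?\<phi> f = ?\<phi> h"
    have eqI: "transform g f = transform g h" if "g \<in> I" for g
    proof -
      have "(\<lambda>g\<in>I. fst (transform g f)) g = (\<lambda>g\<in>I. fst (transform g h)) g" using eq by simp
      then show ?thesis using real[OF that f] real[OF that h] that by simp
    qed
    have eqJ: "transform g f = transform g h" if "g \<in> J" for g
    proof -
      have "(\<lambda>g\<in>J. transform g f) g = (\<lambda>g\<in>J. transform g h) g" using eq by simp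
      then show ?thesis using that by simp
    qed
    show "f = h"
    proof (rule transform_inj[OF f h])
      fix g assume g: "g \<in> carrier G"
      then consider "g \<in> I" | "g \<in> J" | "inv\<^bsub>G\<^esub> g \<in> J" using IJ by blast
      then show "transform g f = transform g h"
      proof cases
        \<comment> \<open>The value at g is the conjugate of the value at g^-1, on which f and h
          agree.\<close>
        case 3
        then show ?thesis
          using conj_transform[OF G.inv_closed[OF g] f] conj_transform[OF G.inv_closed[OF g] h] eqJ[OF 3] g
          by simp
      qed (use eqI eqJ in auto)
    qed
  qed
  \<comment> \<open>A point of \<open>I\<close> contributes one coordinate in R, a point of
    \<open>J\<close> one in R[i], which counts as two over R. The hypothesis \<open>card\<close>
    makes the totals agree.\<close>
  moreover have "card (carrier RG) = card (carrier ?M)"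
    using assms(2) fin
    by (simp add: card_RG card card_PiE card_cartesian_product power_add power_mult power2_eq_square)
  ultimately have "bij_betw ?\<phi> (carrier RG) (carrier ?M)"
    by (intro bij_betw_of_inj_on_card hom_carrier)
       (use hom assms(2) fin in \<open>auto simp: hom_def intro!: finite_PiE\<close>)
  from units_of_iso[OF hom one this RG.monoid_axioms] show ?thesis
    by (simp add: units_of_product_group units_of_DirProd)
qed

section \<open>Odd characteristic\<close>

abbreviation C4xC2cube :: "(int \<times> (nat \<Rightarrow> int)) monoid" where
  "C4xC2cube \<equiv> integer_mod_group 4 \<times>\<times> cyclic_power 2 3"

lemma carrier_C4xC2cube: "carrier C4xC2cube = {0..<4} \<times> ({..<3} \<rightarrow>\<^sub>E {0..<2})"
  by (simp add: carrier_integer_mod_group)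

lemma finite_C4xC2cube: "finite (carrier C4xC2cube)"
  unfolding carrier_C4xC2cube by (intro finite_cartesian_product finite_PiE) auto

lemma card_times_C2cube: "card (A \<times> ({..<3::nat} \<rightarrow>\<^sub>E {0..<2::int})) = 8 * card A"
  by (simp add: card_cartesian_product card_PiE)

lemma comm_group_C4xC2cube: "comm_group C4xC2cube"
proof (rule group.group_comm_groupI)
  show "group C4xC2cube" by (intro DirProd_group) auto
  show "x \<otimes>\<^bsub>C4xC2cube\<^esub> y = y \<otimes>\<^bsub>C4xC2cube\<^esub> x" for x y
    by (simp add: mult_DirProd' add.commute)
qed

lemma inv_C4xC2cube:
  assumes "g \<in> carrier C4xC2cube"
  shows "inv\<^bsub>C4xC2cube\<^esub> g = ((- fst g) mod 4, \<lambda>k\<in>{..<3}. (- snd g k) mod 2)"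
proof -
  have g: "fst g \<in> carrier (integer_mod_group 4)" "snd g \<in> carrier (cyclic_power 2 3)"
    using assms unfolding carrier_DirProd by (simp_all only: mem_Times_iff)
  have "inv\<^bsub>C4xC2cube\<^esub> (fst g, snd g) =
      (inv\<^bsub>integer_mod_group 4\<^esub> (fst g), inv\<^bsub>cyclic_power 2 3\<^esub> (snd g))"
    by (rule inv_DirProd[OF _ _ g]) auto
  moreover have "inv\<^bsub>cyclic_power 2 3\<^esub> (snd g) = (\<lambda>k\<in>{..<3}. inv\<^bsub>integer_mod_group 2\<^esub> (snd g k))"
    by (rule inv_product_group) (use g in simp_all)
  moreover have "(\<lambda>k\<in>{..<3}. inv\<^bsub>integer_mod_group 2\<^esub> (snd g k)) = (\<lambda>k\<in>{..<3}. (- snd g k) mod 2)"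
  proof (rule restrict_ext)
    fix k :: nat assume "k \<in> {..<3}"
    then have "snd g k \<in> carrier (integer_mod_group 2)"
      using g(2) unfolding carrier_product_group by (rule PiE_mem[rotated])
    then show "inv\<^bsub>integer_mod_group 2\<^esub> (snd g k) = (- snd g k) mod 2" by simp
  qed
  ultimately show ?thesis using g(1) by simp
qed

text \<open>Evaluated on integer representatives, hence meaningful only modulo 4. The factor 2 is
  there because a character of \<open>C_2\<close> takes the values 1 and -1, which are even powers
  of i.\<close>

definition C4xC2cube_form :: "int \<times> (nat \<Rightarrow> int) \<Rightarrow> int \<times> (nat \<Rightarrow> int) \<Rightarrow> int" where
  "C4xC2cube_form g h = fst g * fst h + 2 * (\<Sum>k<3. snd g k * snd h k)"

lemma C4xC2cube_form_sym: "C4xC2cube_form g h = C4xC2cube_form h g"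
  by (simp add: C4xC2cube_form_def mult.commute)

text \<open>Reduction of the first coordinate changes the form by a multiple of 4. Reduction of the
  others changes them by multiples of 2, and the factor 2 in front makes these multiples of 4 as
  well.\<close>

lemma C4xC2cube_form_add:
  "C4xC2cube_form (g \<otimes>\<^bsub>C4xC2cube\<^esub> g') h mod 4 = (C4xC2cube_form g h + C4xC2cube_form g' h) mod 4"
proof -
  let ?r = "\<lambda>k. (snd g k + snd g' k) div 2 * snd h k"
  have "C4xC2cube_form (g \<otimes>\<^bsub>C4xC2cube\<^esub> g') h =
      (fst g + fst g') mod 4 * fst h + (\<Sum>k<3. 2 * ((snd g k + snd g' k) mod 2 * snd h k))"
    by (simp add: C4xC2cube_form_def mult_DirProd' sum_distrib_left)
  also have "\<dots> = C4xC2cube_form g h + C4xC2cube_form g' h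
      - 4 * ((fst g + fst g') div 4 * fst h + (\<Sum>k<3. ?r k))"
    by (simp add: C4xC2cube_form_def sum_distrib_left minus_div_mult_eq_mod[symmetric]
        algebra_simps sum.distrib sum_subtractf)
  finally show ?thesis by (simp add: mod_diff_eq flip: mod_diff_right_eq)
qed

lemma C4xC2cube_form_one: "C4xC2cube_form g \<one>\<^bsub>C4xC2cube\<^esub> = 0"
  by (simp add: C4xC2cube_form_def)

lemma C4xC2cube_form_inv:
  assumes "g \<in> carrier C4xC2cube"
  shows "C4xC2cube_form (inv\<^bsub>C4xC2cube\<^esub> g) h mod 4 = (- C4xC2cube_form g h) mod 4"
proof -
  interpret comm_group C4xC2cube by (rule comm_group_C4xC2cube)
  have "(C4xC2cube_form (inv\<^bsub>C4xC2cube\<^esub> g) h + C4xC2cube_form g h) mod 4 = 0"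
    using C4xC2cube_form_add[of "inv\<^bsub>C4xC2cube\<^esub> g" g h] l_inv[OF assms]
      C4xC2cube_form_one[of h] C4xC2cube_form_sym[of h] by simp
  then show ?thesis
    by (metis add.commute add.right_neutral add_diff_cancel_right' diff_minus_eq_add mod_diff_eq
        mod_add_right_eq uminus_add_conv_diff)
qed

text \<open>If the first coordinate of h is nonzero, the generator of \<open>C_4\<close> returns
  that coordinate. Otherwise h has a coordinate 1 in \<open>C_2^3\<close>, and the unit vector there
  gives the value 2.\<close>

lemma C4xC2cube_form_nondegenerate:
  assumes h: "h \<in> carrier C4xC2cube" "h \<noteq> \<one>\<^bsub>C4xC2cube\<^esub>"
  shows "\<exists>g\<in>carrier C4xC2cube. C4xC2cube_form g h mod 4 \<noteq> 0"
proof (cases "fst h = 0")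
  case False
  have "fst h \<in> {0..<4}"
    using h(1) unfolding carrier_C4xC2cube by (simp only: mem_Times_iff)
  with False have "fst h mod 4 \<noteq> 0" by simp
  moreover have "C4xC2cube_form (1, \<lambda>k\<in>{..<3}. 0) h = fst h"
    by (simp add: C4xC2cube_form_def)
  ultimately have "C4xC2cube_form (1, \<lambda>k\<in>{..<3}. 0) h mod 4 \<noteq> 0" by simp
  then show ?thesis by (intro bexI[of _ "(1, \<lambda>k\<in>{..<3}. 0)"]) (auto simp: carrier_integer_mod_group)
next
  case True
  have hT: "snd h \<in> {..<3} \<rightarrow>\<^sub>E {0..<2}"
    using h(1) unfolding carrier_C4xC2cube by (simp only: mem_Times_iff)
  have "\<exists>k<3. snd h k \<noteq> 0"
  proof (rule ccontr)
    assume "\<not> (\<exists>k<3. snd h k \<noteq> 0)"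
    then have "snd h = (\<lambda>k\<in>{..<3}. 0)"
      using hT by (intro PiE_ext[of "snd h" "{..<3}" "\<lambda>_. {0..<2}"]) auto
    with True h show False by (simp add: prod_eq_iff)
  qed
  then obtain k where k: "k < 3" "snd h k \<noteq> 0" by auto
  have "snd h k \<in> {0..<2}" using PiE_mem[OF hT] k by simp
  with k have hk: "snd h k = 1" by auto
  have "(\<Sum>j<3. (if j = k then 1 else 0) * snd h j) = (\<Sum>j<3. if j = k then 1 else 0)"
    by (rule sum.cong) (auto simp: hk)
  then have "C4xC2cube_form (0, \<lambda>j\<in>{..<3}. if j = k then 1 else 0) h = 2"
    using k by (simp add: C4xC2cube_form_def)
  then show ?thesis
    by (intro bexI[of _ "(0, \<lambda>j\<in>{..<3}. if j = k then 1 else 0)"]) (auto simp: carrier_integer_mod_group)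
qed

text \<open>The power i^k for an integer k when i i = -1. The case distinction gives negative
  exponents a meaning in a mere ring and makes dependence on k modulo 4 immediate.\<close>

definition mod4_pow :: "('a, 'b) ring_scheme \<Rightarrow> 'a \<Rightarrow> int \<Rightarrow> 'a" where
  "mod4_pow S i k = (if k mod 4 = 0 then \<one>\<^bsub>S\<^esub> else if k mod 4 = 1 then i
     else if k mod 4 = 2 then \<ominus>\<^bsub>S\<^esub> \<one>\<^bsub>S\<^esub> else \<ominus>\<^bsub>S\<^esub> i)"

lemma mod4_pow_cong: "k mod 4 = l mod 4 \<Longrightarrow> mod4_pow S i k = mod4_pow S i l"
  by (simp add: mod4_pow_def)

lemma mod4_cases:
  fixes k :: int
  obtains "k mod 4 = 0" | "k mod 4 = 1" | "k mod 4 = 2" | "k mod 4 = (3::int)"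
proof -
  have "k mod 4 = 0 \<or> k mod 4 = 1 \<or> k mod 4 = 2 \<or> k mod 4 = (3::int)" by presburger
  then show ?thesis by (elim disjE) (erule that)+
qed

lemma minus_mod4:
  fixes k :: int
  shows "k mod 4 = 0 \<Longrightarrow> (- k) mod 4 = 0" "k mod 4 = 1 \<Longrightarrow> (- k) mod 4 = 3"
    "k mod 4 = 2 \<Longrightarrow> (- k) mod 4 = 2" "k mod 4 = 3 \<Longrightarrow> (- k) mod 4 = 1"
  by presburger+

context domain
begin

lemma mod4_pow_closed [simp]: "i \<in> carrier R \<Longrightarrow> mod4_pow R i k \<in> carrier R"
  by (simp add: mod4_pow_def)

lemma mod4_pow_0: "mod4_pow R i 0 = \<one>"
  by (simp add: mod4_pow_def)

context
  fixes i
  assumes i: "i \<in> carrier R" "i \<otimes> i = \<ominus> \<one>"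
begin

lemma mod4_pow_values:
  "k mod 4 = 0 \<Longrightarrow> mod4_pow R i k = \<one>" "k mod 4 = 1 \<Longrightarrow> mod4_pow R i k = i"
  "k mod 4 = 2 \<Longrightarrow> mod4_pow R i k = \<ominus> \<one>" "k mod 4 = 3 \<Longrightarrow> mod4_pow R i k = \<ominus> i"
  by (simp_all add: mod4_pow_def)

lemma mod4_pow_add: "mod4_pow R i (k + l) = mod4_pow R i k \<otimes> mod4_pow R i l"
proof -
  have "(k + l) mod 4 = (k mod 4 + l mod 4) mod 4" by (simp add: mod_simps)
  then show ?thesis
    by (cases k rule: mod4_cases; cases l rule: mod4_cases)
       (use i in \<open>simp_all add: mod4_pow_values l_minus r_minus\<close>)
qed

text \<open>When 1 and -1 differ, i has order exactly 4, since i = 1 or -i = 1 would give i i = 1.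
  This carries nondegeneracy from the form to the pairing.\<close>

lemma mod4_pow_eq_one:
  assumes two: "\<one> \<oplus> \<one> \<noteq> \<zero>" and eq: "mod4_pow R i k = \<one>"
  shows "k mod 4 = 0"
proof -
  have m1: "\<ominus> \<one> \<noteq> \<one>"
    using two by (metis l_neg one_closed)
  then have "i \<noteq> \<one>" using i by auto
  moreover have "\<ominus> i \<noteq> \<one>"
  proof
    assume "\<ominus> i = \<one>"
    then have "i = \<ominus> \<one>" using i(1) by (metis minus_minus)
    then have "i \<otimes> i = \<one>" by (simp add: l_minus)
    with i m1 show False by simp
  qed
  ultimately show ?thesis
    using eq m1 by (cases k rule: mod4_cases) (simp_all add: mod4_pow_values)
qed

end

text \<open>Meant for the group order 32 = 2^5: each doubling multiplies by 1 + 1, and a domain has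
  no zero divisors.\<close>

lemma two_power_nonzero:
  assumes "\<one> \<oplus> \<one> \<noteq> \<zero>"
  shows "[(2 ^ k :: nat)] \<cdot> \<one> \<noteq> \<zero>"
proof (induction k)
  case (Suc k)
  have "[(2 ^ Suc k :: nat)] \<cdot> \<one> = [(2 ^ k + 2 ^ k :: nat)] \<cdot> \<one>" by (simp add: mult_2)
  also have "\<dots> = [(2 ^ k :: nat)] \<cdot> \<one> \<oplus> [(2 ^ k :: nat)] \<cdot> \<one>"
    by (rule add.nat_pow_mult [symmetric]) simp
  also have "\<dots> = (\<one> \<oplus> \<one>) \<otimes> [(2 ^ k :: nat)] \<cdot> \<one>" by (simp add: l_distr)
  finally show ?case using Suc assms by (simp add: integral_iff)
qed simp

end

lemma C4xC2cube_pairing: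
  fixes R (structure) and S (structure)
  assumes R: "cring R" and S: "domain S" and \<iota>: "\<iota> \<in> ring_hom R S" "inj_on \<iota> (carrier R)"
    and i: "i \<in> carrier S" "i \<otimes>\<^bsub>S\<^esub> i = \<ominus>\<^bsub>S\<^esub> \<one>\<^bsub>S\<^esub>" and two: "\<one>\<^bsub>S\<^esub> \<oplus>\<^bsub>S\<^esub> \<one>\<^bsub>S\<^esub> \<noteq> \<zero>\<^bsub>S\<^esub>"
  shows "nondegenerate_pairing R C4xC2cube S \<iota> (\<lambda>g h. mod4_pow S i (C4xC2cube_form g h))"
proof -
  interpret R: cring R by fact
  interpret S: domain S by fact
  interpret G: comm_group C4xC2cube by (rule comm_group_C4xC2cube)
  note add = C4xC2cube_form_add
  show ?thesis
  proof (unfold_locales)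
    show "finite (carrier C4xC2cube)" by (rule finite_C4xC2cube)
    show "\<iota> \<in> ring_hom R S" "inj_on \<iota> (carrier R)" by fact+
  next
    fix g h show "mod4_pow S i (C4xC2cube_form g h) \<in> carrier S" using i by simp
  next
    fix g g' h
    show "mod4_pow S i (C4xC2cube_form (g \<otimes>\<^bsub>C4xC2cube\<^esub> g') h) =
        mod4_pow S i (C4xC2cube_form g h) \<otimes>\<^bsub>S\<^esub> mod4_pow S i (C4xC2cube_form g' h)"
      using mod4_pow_cong[OF add] S.mod4_pow_add[OF i] by metis
    show "mod4_pow S i (C4xC2cube_form h (g \<otimes>\<^bsub>C4xC2cube\<^esub> g')) =
        mod4_pow S i (C4xC2cube_form h g) \<otimes>\<^bsub>S\<^esub> mod4_pow S i (C4xC2cube_form h g')"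
      using mod4_pow_cong[OF add] S.mod4_pow_add[OF i] by (metis C4xC2cube_form_sym)
  next
    fix g show "mod4_pow S i (C4xC2cube_form g \<one>\<^bsub>C4xC2cube\<^esub>) = \<one>\<^bsub>S\<^esub>"
      unfolding C4xC2cube_form_one by (rule S.mod4_pow_0)
  next
    fix h assume "h \<in> carrier C4xC2cube" "h \<noteq> \<one>\<^bsub>C4xC2cube\<^esub>"
    then show "\<exists>g\<in>carrier C4xC2cube. mod4_pow S i (C4xC2cube_form g h) \<noteq> \<one>\<^bsub>S\<^esub>"
      using C4xC2cube_form_nondegenerate S.mod4_pow_eq_one[OF i two] by blast
  next
    have "card (carrier C4xC2cube) = 2 ^ 5"
      unfolding carrier_C4xC2cube card_times_C2cube by simp
    then show "[card (carrier C4xC2cube)] \<cdot>\<^bsub>S\<^esub> \<one>\<^bsub>S\<^esub> \<noteq> \<zero>\<^bsub>S\<^esub>"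
      using S.two_power_nonzero[OF two, of 5] by simp
  qed
qed

text \<open>The unit group has order 4 m, but X^(2m) - 1 has at most 2 m roots. So some unit a has
  a^(2m) different from 1; its square is 1, whence a^(2m) = -1 and i = a^m works.\<close>

lemma (in field) exists_sqrt_minus_one:
  assumes fin: "finite (carrier R)" and q: "card (carrier R) mod 4 = 1"
  shows "\<exists>i\<in>carrier R. i \<otimes> i = \<ominus> \<one>"
proof -
  let ?q = "card (carrier R)"
  have q1: "?q \<noteq> 1"
  proof
    assume "?q = 1"
    then obtain x where "carrier R = {x}" by (rule card_1_singletonE)
    then show False using zero_closed one_closed zero_not_one by simp
  qed
  obtain m where m: "?q = 4 * m + 1" using q by (metis mult_div_mod_eq)
  with q1 have m0: "m > 0" by (cases m) auto
  have cU: "card (Units R) = 4 * m"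
    using m fin by (simp add: field_Units)
  have finU: "finite (Units R)" using fin by (simp add: field_Units)
  have "card {x \<in> carrier R. x [^] (2 * m) = \<one>} \<le> 2 * m"
    using num_roots_le_deg[OF fin, of "2 * m"] m0 by simp
  then have "\<not> Units R \<subseteq> {x \<in> carrier R. x [^] (2 * m) = \<one>}"
    using card_mono[of "{x \<in> carrier R. x [^] (2 * m) = \<one>}" "Units R"] fin cU m0 by auto
  then obtain a where a: "a \<in> Units R" "a [^] (2 * m) \<noteq> \<one>" by (auto simp: Units_closed)
  have aR: "a \<in> carrier R" using a by (simp add: Units_closed)
  have "a [^] (2 * m) \<otimes> a [^] (2 * m) = a [^] (4 * m)" using aR by (simp add: nat_pow_mult)
  also have "\<dots> = \<one>" using units_power_order_eq_one[OF finU a(1)] cU by simp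
  finally have "a [^] (2 * m) = \<ominus> \<one>" using a(2) aR square_eq_one by auto
  then have "a [^] m \<otimes> a [^] m = \<ominus> \<one>" using aR by (simp add: nat_pow_mult mult_2)
  with aR show ?thesis by blast
qed

text \<open>The unit group has order 4 m + 2. A root i would satisfy 1 = i^(4m+2) = (-1)^(2m+1) =
  -1.\<close>

lemma (in field) no_sqrt_minus_one:
  assumes fin: "finite (carrier R)" and two: "\<one> \<oplus> \<one> \<noteq> \<zero>" and q: "card (carrier R) mod 4 = 3"
    and i: "i \<in> carrier R"
  shows "i \<otimes> i \<noteq> \<ominus> \<one>"
proof
  assume ii: "i \<otimes> i = \<ominus> \<one>"
  obtain m where m: "card (carrier R) = 4 * m + 3" using q by (metis mult_div_mod_eq)
  have "i \<noteq> \<zero>" using ii by (metis i integral_iff l_null minus_minus minus_zero one_closed zero_not_one)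
  then have iU: "i \<in> Units R" using i by (simp add: field_Units)
  have "card (Units R) = 4 * m + 2" using m fin by (simp add: field_Units)
  then have "i [^] (4 * m + 2) = \<one>"
    using units_power_order_eq_one[OF _ iU] fin by (simp add: field_Units)
  also have "4 * m + 2 = 2 * (2 * m + 1)" by simp
  also have "i [^] (2 * (2 * m + 1)) = (i \<otimes> i) [^] (2 * m + 1)"
    using i by (simp add: nat_pow_pow[symmetric] numeral_2_eq_2 m_assoc del: mult_Suc)
  also have "\<dots> = (\<ominus> \<one> \<otimes> \<ominus> \<one>) [^] m \<otimes> \<ominus> \<one>"
    by (simp add: ii nat_pow_pow[symmetric] numeral_2_eq_2 l_minus del: mult_Suc)
  also have "\<dots> = \<ominus> \<one>" by (simp add: l_minus)
  finally have "\<one> \<oplus> \<one> = \<zero>" by (metis l_neg one_closed)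
  with two show False by simp
qed

section \<open>The unit group for odd q, by the residue of q modulo 4\<close>

lemma units_group_algebra_1_mod_4:
  fixes F (structure)
  assumes "field F" and fin: "finite (carrier F)" and two: "\<one> \<oplus> \<one> \<noteq> \<zero>"
    and q: "card (carrier F) mod 4 = 1"
  shows "units_of (group_algebra F C4xC2cube) \<cong> cyclic_power (card (carrier F) - 1) 32"
proof -
  interpret field F by fact
  obtain i where i: "i \<in> carrier F" "i \<otimes> i = \<ominus> \<one>"
    using exists_sqrt_minus_one[OF fin q] by blast
  have "units_of (group_algebra F C4xC2cube) \<cong> product_group (carrier C4xC2cube) (\<lambda>_. units_of F)"
    by (rule units_group_algebra_split[OF C4xC2cube_pairing[OF is_cring domain_axioms _ _ i two] fin])
       auto
  also have "\<dots> \<cong> product_group {..<32::nat} (\<lambda>_. units_of F)"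
  proof (rule product_group_card_iso[OF finite_C4xC2cube])
    show "card (carrier C4xC2cube) = 32"
      unfolding carrier_C4xC2cube card_times_C2cube by simp
  qed
  also have "\<dots> \<cong> cyclic_power (card (carrier F) - 1) 32"
    by (intro iso_product_groupI units_of_iso_integer_mod_group fin units_group group_integer_mod_group)
  finally show ?thesis .
qed

lemma units_group_algebra_3_mod_4:
  fixes F (structure)
  assumes "field F" and fin: "finite (carrier F)" and two: "\<one> \<oplus> \<one> \<noteq> \<zero>"
    and q: "card (carrier F) mod 4 = 3"
  shows "units_of (group_algebra F C4xC2cube) \<cong>
    cyclic_power (card (carrier F) - 1) 16 \<times>\<times> cyclic_power (card (carrier F) ^ 2 - 1) 8"
proof -
  interpret field F by fact
  let ?K = "adjoin_i F"
  interpret K: field ?K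
    by (rule adjoin_i_field) (rule no_sqrt_minus_one[OF fin two q])
  let ?i = "(\<zero>, \<one>)"
  have minus_one: "\<ominus>\<^bsub>?K\<^esub> \<one>\<^bsub>?K\<^esub> = (\<ominus> \<one>, \<zero>)"
    by (rule K.minus_equality) (auto simp: l_neg)
  have minus_i: "\<ominus>\<^bsub>?K\<^esub> ?i = (\<zero>, \<ominus> \<one>)"
    by (rule K.minus_equality) (auto simp: l_neg)
  have i: "?i \<in> carrier ?K" "?i \<otimes>\<^bsub>?K\<^esub> ?i = \<ominus>\<^bsub>?K\<^esub> \<one>\<^bsub>?K\<^esub>"
    unfolding minus_one by (auto simp: minus_eq)
  have twoK: "\<one>\<^bsub>?K\<^esub> \<oplus>\<^bsub>?K\<^esub> \<one>\<^bsub>?K\<^esub> \<noteq> \<zero>\<^bsub>?K\<^esub>" using two by simp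
  let ?b = "\<lambda>g h. mod4_pow ?K ?i (C4xC2cube_form g h)"
  let ?T = "{..<3::nat} \<rightarrow>\<^sub>E {0..<2::int}"
  \<comment> \<open>The elements of \<open>?I\<close> are their own inverses: the first coordinate
    is 0 or 2 and the others have order at most 2. Inversion exchanges the first coordinates 1 and
    3, so \<open>?J\<close> contains one element of each remaining pair.\<close>
  let ?I = "{0, 2 :: int} \<times> ?T" and ?J = "{1 :: int} \<times> ?T"
  have finT: "finite ?T" by (intro finite_PiE) auto
  have pairing: "nondegenerate_pairing F C4xC2cube ?K (\<lambda>a. (a, \<zero>)) ?b"
    by (rule C4xC2cube_pairing[OF is_cring K.domain_axioms adjoin_i_embedding _ i twoK])
       (auto simp: inj_on_def)
  have "units_of (group_algebra F C4xC2cube) \<cong>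
      product_group ?I (\<lambda>_. units_of F) \<times>\<times> product_group ?J (\<lambda>_. units_of ?K)"
  proof (rule units_group_algebra_split_conj[OF pairing fin _ _ _ _ _ _ two domain_axioms])
    fix g h assume g: "g \<in> carrier C4xC2cube"
    have eq: "?b (inv\<^bsub>C4xC2cube\<^esub> g) h = mod4_pow ?K ?i (- C4xC2cube_form g h)"
      by (rule mod4_pow_cong[OF C4xC2cube_form_inv[OF g]])
    show "?b (inv\<^bsub>C4xC2cube\<^esub> g) h = (case ?b g h of (u, v) \<Rightarrow> (u, \<ominus> v))"
      unfolding eq
      by (cases "C4xC2cube_form g h" rule: mod4_cases)
         (simp_all add: minus_mod4 K.mod4_pow_values[OF i] minus_one[simplified] minus_i)
  next
    show "?I \<subseteq> carrier C4xC2cube" "?J \<subseteq> carrier C4xC2cube"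
      unfolding carrier_C4xC2cube by (intro Sigma_mono; simp)+
    have T: "(\<lambda>k\<in>{..<3}. (- t k) mod 2) = t" if "t \<in> ?T" for t
    proof (rule PiE_ext[of _ "{..<3}" "\<lambda>_. {0..<2}"])
      fix k :: nat assume "k \<in> {..<3}"
      with PiE_mem[OF that] have "t k \<in> {0..<2}" by simp
      then have "t k = 0 \<or> t k = 1" by auto
      with \<open>k \<in> {..<3}\<close> show "(\<lambda>k\<in>{..<3}. (- t k) mod 2) k = t k" by auto
    qed (use that in auto)
    show "inv\<^bsub>C4xC2cube\<^esub> g = g" if "g \<in> ?I" for g
    proof -
      have sg: "snd g \<in> ?T" and fg: "fst g = 0 \<or> fst g = 2" using that by (simp_all add: mem_Times_iff)
      from fg have "fst g \<in> {0..<4}" by auto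
      with sg have "g \<in> carrier C4xC2cube"
        unfolding carrier_C4xC2cube by (simp only: mem_Times_iff)
      then have "inv\<^bsub>C4xC2cube\<^esub> g = ((- fst g) mod 4, snd g)"
        using T[OF sg] by (simp only: inv_C4xC2cube)
      then show ?thesis using fg by (auto simp: prod_eq_iff)
    qed
    show "g \<in> ?I \<or> g \<in> ?J \<or> inv\<^bsub>C4xC2cube\<^esub> g \<in> ?J" if g: "g \<in> carrier C4xC2cube" for g
    proof -
      have sg: "snd g \<in> ?T" and fg: "fst g \<in> {0..<4}"
        using g unfolding carrier_C4xC2cube by (simp_all only: mem_Times_iff)
      have "inv\<^bsub>C4xC2cube\<^esub> g = ((- fst g) mod 4, snd g)"
        using T[OF sg] g by (simp only: inv_C4xC2cube)
      moreover have "fst g = 0 \<or> fst g = 1 \<or> fst g = 2 \<or> fst g = 3"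
        using fg by auto
      ultimately show ?thesis by (elim disjE) (simp_all add: mem_Times_iff sg)
    qed
    show "card (carrier C4xC2cube) = card ?I + 2 * card ?J"
      unfolding carrier_C4xC2cube card_times_C2cube by simp
  qed
  also have "\<dots> \<cong> product_group {..<16::nat} (\<lambda>_. units_of F) \<times>\<times> product_group {..<8::nat} (\<lambda>_. units_of ?K)"
    by (intro DirProd_cong_iso product_group_card_iso product_group units_group K.units_group)
       (use finT in \<open>auto simp: card_times_C2cube\<close>)
  also have "\<dots> \<cong> cyclic_power (card (carrier F) - 1) 16 \<times>\<times> cyclic_power (card (carrier ?K) - 1) 8"
    by (intro DirProd_cong_iso iso_product_groupI units_of_iso_integer_mod_group
        K.units_of_iso_integer_mod_group product_group units_group K.units_group group_integer_mod_group)
       (use fin in auto)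
  finally show ?thesis
    by (simp add: card_cartesian_product power2_eq_square)
qed

section \<open>Characteristic two\<close>

text \<open>The terms at y and \<open>\<sigma> y\<close> are equal and add to zero. The induction
  removes one such pair at a time, and the rest remains invariant under
  \<open>\<sigma>\<close>.\<close>

lemma (in abelian_monoid) finsum_involution:
  assumes char2: "\<And>x. x \<in> carrier G \<Longrightarrow> x \<oplus> x = \<zero>"
    and "finite A" "f \<in> A \<rightarrow> carrier G"
    and "\<And>y. y \<in> A \<Longrightarrow> \<sigma> y \<in> A \<and> \<sigma> (\<sigma> y) = y \<and> \<sigma> y \<noteq> y \<and> f (\<sigma> y) = f y"
  shows "(\<Oplus>y\<in>A. f y) = \<zero>"
  using assms(2-4)
proof (induction A rule: finite_psubset_induct)
  case (psubset A)
  show ?case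
  proof (cases "A = {}")
    case False
    then obtain y where y: "y \<in> A" by blast
    let ?B = "A - {y, \<sigma> y}"
    have \<sigma>y: "\<sigma> y \<in> A" "\<sigma> (\<sigma> y) = y" "\<sigma> y \<noteq> y" "f (\<sigma> y) = f y" using psubset.prems(2) y by blast+
    have f: "f z \<in> carrier G" if "z \<in> A" for z using psubset.prems(1) that by blast
    have B: "(\<Oplus>z\<in>?B. f z) = \<zero>"
    proof (rule psubset.IH)
      fix z assume z: "z \<in> ?B"
      then have "\<sigma> z \<in> A" "\<sigma> (\<sigma> z) = z" "\<sigma> z \<noteq> z" "f (\<sigma> z) = f z" using psubset.prems(2) by blast+
      moreover have "\<sigma> z \<noteq> y" "\<sigma> z \<noteq> \<sigma> y" using z \<sigma>y calculation(2) by auto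
      ultimately show "\<sigma> z \<in> ?B \<and> \<sigma> (\<sigma> z) = z \<and> \<sigma> z \<noteq> z \<and> f (\<sigma> z) = f z" by blast
    qed (use y f in auto)
    have "A = insert y (insert (\<sigma> y) ?B)" using y \<sigma>y by auto
    then have "(\<Oplus>z\<in>A. f z) = (\<Oplus>z\<in>insert y (insert (\<sigma> y) ?B). f z)" by simp
    also have "\<dots> = f y \<oplus> (\<Oplus>z\<in>insert (\<sigma> y) ?B. f z)"
      by (rule finsum_insert) (use psubset.hyps \<sigma>y y f in auto)
    also have "(\<Oplus>z\<in>insert (\<sigma> y) ?B. f z) = f (\<sigma> y) \<oplus> (\<Oplus>z\<in>?B. f z)"
      by (rule finsum_insert) (use psubset.hyps \<sigma>y y f in auto)
    finally show ?thesis using B \<sigma>y f[OF y] char2 by simp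
  qed simp
qed

text \<open>Isolates what matters about the group: it has a single nontrivial square c, with a
  chosen root \<open>x0\<close>.\<close>

locale char_two_group_algebra = finite_group_algebra R G + field R for R (structure) and G (structure) +
  fixes c x0
  assumes finite_R: "finite (carrier R)" and char_two: "\<one> \<oplus> \<one> = \<zero>"
    and c: "c \<noteq> \<one>\<^bsub>G\<^esub>" and x0: "x0 \<in> carrier G" "x0 \<otimes>\<^bsub>G\<^esub> x0 = c"
    and squares: "\<And>y. y \<in> carrier G \<Longrightarrow> y \<otimes>\<^bsub>G\<^esub> y = \<one>\<^bsub>G\<^esub> \<or> y \<otimes>\<^bsub>G\<^esub> y = c"
begin

lemma c_closed [simp]: "c \<in> carrier G"
  using x0 G.m_closed by blast

lemma x0_not_one: "x0 \<noteq> \<one>\<^bsub>G\<^esub>"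
  using x0 c by auto

lemma cc: "c \<otimes>\<^bsub>G\<^esub> c = \<one>\<^bsub>G\<^esub>"
  using squares[OF c_closed] c by (metis G.l_cancel_one c_closed)

lemma add_self: "a \<in> carrier R \<Longrightarrow> a \<oplus> a = \<zero>"
  by (metis char_two l_distr l_null l_one one_closed)

lemma square_add:
  assumes "a \<in> carrier R" "d \<in> carrier R"
  shows "(a \<oplus> d) \<otimes> (a \<oplus> d) = a \<otimes> a \<oplus> d \<otimes> d"
proof -
  have "(a \<oplus> d) \<otimes> (a \<oplus> d) = a \<otimes> a \<oplus> d \<otimes> d \<oplus> (a \<otimes> d \<oplus> a \<otimes> d)"
    using assms by algebra
  then show ?thesis using assms by (simp add: add_self)
qed

lemma add_cancel [simp]: "a \<in> carrier R \<Longrightarrow> d \<in> carrier R \<Longrightarrow> a \<oplus> d \<oplus> d = a"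
  by (simp add: a_assoc add_self)

text \<open>Squaring is additive in characteristic 2, hence injective on a field, hence onto by
  finiteness.\<close>

lemma exists_sqrt:
  assumes "a \<in> carrier R"
  shows "\<exists>d\<in>carrier R. d \<otimes> d = a"
proof -
  have "inj_on (\<lambda>d. d \<otimes> d) (carrier R)"
  proof (rule inj_onI)
    fix d e assume de: "d \<in> carrier R" "e \<in> carrier R" "d \<otimes> d = e \<otimes> e"
    then have "(d \<oplus> e) \<otimes> (d \<oplus> e) = \<zero>" by (simp add: square_add add_self)
    then have "d \<oplus> e = \<zero>" using de integral by blast
    then show "d = e" using de add_cancel by (metis l_zero)
  qed
  then have "(\<lambda>d. d \<otimes> d) ` carrier R = carrier R"
    using finite_R by (intro endo_inj_surj) auto
  then have "a \<in> (\<lambda>d. d \<otimes> d) ` carrier R" using assms by simp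
  then show ?thesis by (elim imageE) auto
qed

text \<open>The map from y to y^-1 x exchanges the two factors of the product f(y) f(y^-1 x). Its
  fixed points are the square roots of x; all other terms cancel with their images.\<close>

lemma square_apply:
  assumes f: "f \<in> carrier RG" and x: "x \<in> carrier G"
  shows "(f \<otimes>\<^bsub>RG\<^esub> f) x = (\<Oplus>y\<in>{y \<in> carrier G. y \<otimes>\<^bsub>G\<^esub> y = x}. f y \<otimes> f y)"
proof -
  let ?A = "{y \<in> carrier G. y \<otimes>\<^bsub>G\<^esub> y = x}" and ?B = "{y \<in> carrier G. y \<otimes>\<^bsub>G\<^esub> y \<noteq> x}"
  let ?t = "\<lambda>y. f y \<otimes> f (inv\<^bsub>G\<^esub> y \<otimes>\<^bsub>G\<^esub> x)"
  have AB: "carrier G = ?A \<union> ?B" by blast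
  have closed: "?t y \<in> carrier R" if "y \<in> carrier G" for y using f x that by simp
  have "(f \<otimes>\<^bsub>RG\<^esub> f) x = (\<Oplus>y\<in>?A \<union> ?B. ?t y)"
    using f x by (simp add: mult_RG_apply flip: AB)
  also have "\<dots> = (\<Oplus>y\<in>?A. ?t y) \<oplus> (\<Oplus>y\<in>?B. ?t y)"
    by (rule finsum_Un_disjoint) (use finite_G closed in auto)
  also have "(\<Oplus>y\<in>?B. ?t y) = \<zero>"
  proof (rule finsum_involution)
    fix y assume "y \<in> ?B"
    then have y: "y \<in> carrier G" "y \<otimes>\<^bsub>G\<^esub> y \<noteq> x" by auto
    let ?s = "\<lambda>y. inv\<^bsub>G\<^esub> y \<otimes>\<^bsub>G\<^esub> x"
    have 1: "?s y \<in> carrier G" using x y by simp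
    have 2: "?s (?s y) = y"
      using x y by (simp add: G.inv_mult G.m_assoc)
    have 3: "?s y \<noteq> y" using y x by (metis G.r_inv G.m_assoc G.inv_closed G.l_one)
    have "?s y \<otimes>\<^bsub>G\<^esub> ?s y \<noteq> x"
    proof
      assume "?s y \<otimes>\<^bsub>G\<^esub> ?s y = x"
      then have "?s (?s y) = ?s y" using 1 x by (metis G_cancel(1))
      with 2 3 show False by simp
    qed
    then show "?s y \<in> ?B \<and> ?s (?s y) = y \<and> ?s y \<noteq> y \<and> ?t (?s y) = ?t y"
      using 1 2 3 f x y by (simp add: m_comm)
  qed (use finite_G closed add_self in auto)
  also have "(\<Oplus>y\<in>?A. ?t y) = (\<Oplus>y\<in>?A. f y \<otimes> f y)"
  proof (rule finsum_cong')
    fix y assume "y \<in> ?A"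
    then have "inv\<^bsub>G\<^esub> y \<otimes>\<^bsub>G\<^esub> x = y" by auto
    then show "?t y = f y \<otimes> f y" by simp
  qed (use f in auto)
  finally show ?thesis using f by (simp add: finsum_closed Pi_def)
qed

lemma square_apply_eq_zero:
  assumes "f \<in> carrier RG" "x \<in> carrier G" "x \<noteq> \<one>\<^bsub>G\<^esub>" "x \<noteq> c"
  shows "(f \<otimes>\<^bsub>RG\<^esub> f) x = \<zero>"
proof -
  have "{y \<in> carrier G. y \<otimes>\<^bsub>G\<^esub> y = x} = {}" using squares assms by blast
  then show ?thesis using assms by (simp only: square_apply finsum_empty)
qed

text \<open>The element a 1 + d z, for z other than 1. With z = c this is the shape of every square,
  with z = \<open>x0\<close> that of the chosen square roots, and with d = 0 that of the
  scalars.\<close>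

definition two_term :: "'c \<Rightarrow> 'a \<Rightarrow> 'a \<Rightarrow> 'c \<Rightarrow> 'a" where
  "two_term z a d = (\<lambda>x\<in>carrier G. if x = \<one>\<^bsub>G\<^esub> then a else if x = z then d else \<zero>)"

lemma two_term_apply [simp]:
  "x \<in> carrier G \<Longrightarrow> two_term z a d x = (if x = \<one>\<^bsub>G\<^esub> then a else if x = z then d else \<zero>)"
  by (simp add: two_term_def)

lemma two_term_closed [simp]: "a \<in> carrier R \<Longrightarrow> d \<in> carrier R \<Longrightarrow> two_term z a d \<in> carrier RG"
  by (auto simp: two_term_def carrier_RG)

lemma one_two_term: "\<one>\<^bsub>RG\<^esub> = two_term z \<one> \<zero>"
  by (auto simp: one_RG two_term_def)

text \<open>The set A is general because the sum runs over the whole group for the augmentation, but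
  over the square roots of a given element for squares.\<close>

lemma finsum_two_point:
  assumes A: "A \<subseteq> carrier G" and z: "z \<in> carrier G" "z \<noteq> \<one>\<^bsub>G\<^esub>" and f: "f \<in> A \<rightarrow> carrier R"
    and f0: "\<And>x. x \<in> A \<Longrightarrow> x \<noteq> \<one>\<^bsub>G\<^esub> \<Longrightarrow> x \<noteq> z \<Longrightarrow> f x = \<zero>"
  shows "(\<Oplus>x\<in>A. f x) = (if \<one>\<^bsub>G\<^esub> \<in> A then f \<one>\<^bsub>G\<^esub> else \<zero>) \<oplus> (if z \<in> A then f z else \<zero>)"
proof -
  have fin: "finite A" using A finite_G by (rule finite_subset)
  have single: "(\<Oplus>x\<in>A. if x = y then f x else \<zero>) = (if y \<in> A then f y else \<zero>)" for y
  proof (cases "y \<in> A")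
    case True
    then show ?thesis using add.finprod_singleton_swap[OF True fin f] by simp
  next
    case False
    then show ?thesis by (auto intro!: add.finprod_one_eqI)
  qed
  have fA: "f x \<in> carrier R" if "x \<in> A" for x using f that by blast
  have "(\<Oplus>x\<in>A. f x) = (\<Oplus>x\<in>A. (if x = \<one>\<^bsub>G\<^esub> then f x else \<zero>) \<oplus> (if x = z then f x else \<zero>))"
    by (rule finsum_cong') (use fA f0 z in auto)
  also have "\<dots> = (\<Oplus>x\<in>A. if x = \<one>\<^bsub>G\<^esub> then f x else \<zero>) \<oplus> (\<Oplus>x\<in>A. if x = z then f x else \<zero>)"
    by (rule finsum_addf) (use fA in auto)
  finally show ?thesis by (simp only: single)
qed

section \<open>The augmentation and the criterion for units\<close>

definition aug where "aug f = (\<Oplus>x\<in>carrier G. f x)"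

text \<open>The augmentation belongs to the trivial character, which is how it inherits
  multiplicativity.\<close>

lemma aug_character_sum: "f \<in> carrier RG \<Longrightarrow> aug f = character_sum R G id (\<lambda>_. \<one>) f"
  unfolding character_sum_def aug_def by (rule finsum_cong') auto

lemma aug_closed [simp]: "f \<in> carrier RG \<Longrightarrow> aug f \<in> carrier R"
  unfolding aug_def by (intro finsum_closed) auto

lemma aug_mult [simp]:
  assumes "f \<in> carrier RG" "h \<in> carrier RG"
  shows "aug (f \<otimes>\<^bsub>RG\<^esub> h) = aug f \<otimes> aug h"
  unfolding aug_character_sum[OF assms(1)] aug_character_sum[OF assms(2)]
    aug_character_sum[OF RG_mult_closed[OF assms]]
  by (rule character_sum_mult) (use assms in \<open>auto simp: is_cring\<close>)

lemma aug_one [simp]: "aug \<one>\<^bsub>RG\<^esub> = \<one>"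
  unfolding aug_character_sum[OF RG_one_closed] by (rule character_sum_one) (auto simp: is_cring)

lemma aug_two_term:
  assumes "a \<in> carrier R" "d \<in> carrier R" "z \<in> carrier G" "z \<noteq> \<one>\<^bsub>G\<^esub>"
  shows "aug (two_term z a d) = a \<oplus> d"
  using assms finsum_two_point[of "carrier G" z "two_term z a d"]
  by (auto simp: aug_def)

lemma square_two_term:
  assumes f: "f \<in> carrier RG"
  shows "f \<otimes>\<^bsub>RG\<^esub> f = two_term c ((f \<otimes>\<^bsub>RG\<^esub> f) \<one>\<^bsub>G\<^esub>) ((f \<otimes>\<^bsub>RG\<^esub> f) c)"
  by (rule RG_eqI) (use f in \<open>auto simp: square_apply_eq_zero\<close>)

text \<open>Since (a + d z)^2 = a^2 + d^2 z^2 in characteristic 2, the two cases come from c c = 1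
  and \<open>x0 x0\<close> = c.\<close>

lemma two_term_square:
  assumes "a \<in> carrier R" "d \<in> carrier R"
  shows "two_term c a d \<otimes>\<^bsub>RG\<^esub> two_term c a d = two_term c ((a \<oplus> d) \<otimes> (a \<oplus> d)) \<zero>"
    and "two_term x0 a d \<otimes>\<^bsub>RG\<^esub> two_term x0 a d = two_term c (a \<otimes> a) (d \<otimes> d)"
proof -
  have val: "(two_term z a d \<otimes>\<^bsub>RG\<^esub> two_term z a d) x =
      (if x = \<one>\<^bsub>G\<^esub> then a \<otimes> a else \<zero>) \<oplus> (if x = z \<otimes>\<^bsub>G\<^esub> z then d \<otimes> d else \<zero>)"
    if "x \<in> carrier G" "z \<in> carrier G" "z \<noteq> \<one>\<^bsub>G\<^esub>" for x z
    using assms that finsum_two_point[of "{y \<in> carrier G. y \<otimes>\<^bsub>G\<^esub> y = x}" z "\<lambda>y. two_term z a d y \<otimes> two_term z a d y"]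
    by (auto simp: square_apply)
  show "two_term c a d \<otimes>\<^bsub>RG\<^esub> two_term c a d = two_term c ((a \<oplus> d) \<otimes> (a \<oplus> d)) \<zero>"
    by (rule RG_eqI) (use assms val c cc in \<open>auto simp: square_add\<close>)
  show "two_term x0 a d \<otimes>\<^bsub>RG\<^esub> two_term x0 a d = two_term c (a \<otimes> a) (d \<otimes> d)"
    by (rule RG_eqI) (use assms val c x0 x0_not_one in auto)
qed

abbreviation scalar where "scalar a \<equiv> two_term c a \<zero>"

lemma scalar_mult_apply:
  assumes "a \<in> carrier R" "f \<in> carrier RG" "x \<in> carrier G"
  shows "(scalar a \<otimes>\<^bsub>RG\<^esub> f) x = a \<otimes> f x"
proof -
  have "(scalar a \<otimes>\<^bsub>RG\<^esub> f) x = (\<Oplus>y\<in>carrier G. scalar a y \<otimes> f (inv\<^bsub>G\<^esub> y \<otimes>\<^bsub>G\<^esub> x))"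
    by (rule mult_RG_apply) (use assms in auto)
  also have "\<dots> = (\<Oplus>y\<in>carrier G. if y = \<one>\<^bsub>G\<^esub> then a \<otimes> f (inv\<^bsub>G\<^esub> y \<otimes>\<^bsub>G\<^esub> x) else \<zero>)"
    by (rule finsum_cong') (use assms in auto)
  also have "\<dots> = a \<otimes> f (inv\<^bsub>G\<^esub> \<one>\<^bsub>G\<^esub> \<otimes>\<^bsub>G\<^esub> x)"
    by (rule add.finprod_singleton_swap) (use assms finite_G in auto)
  finally show ?thesis using assms by simp
qed

lemma scalar_mult:
  assumes "a \<in> carrier R" "d \<in> carrier R"
  shows "scalar a \<otimes>\<^bsub>RG\<^esub> scalar d = scalar (a \<otimes> d)"
  by (rule RG_eqI) (use assms in \<open>auto simp: scalar_mult_apply\<close>)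

lemma aug_scalar: "a \<in> carrier R \<Longrightarrow> aug (scalar a) = a"
  using c by (simp add: aug_two_term)

text \<open>A square is a + d c with a + d the square of the augmentation of f. Squaring again gives
  (a + d)^2 because c c = 1.\<close>

lemma fourth_power:
  assumes f: "f \<in> carrier RG"
  shows "(f \<otimes>\<^bsub>RG\<^esub> f) \<otimes>\<^bsub>RG\<^esub> (f \<otimes>\<^bsub>RG\<^esub> f) = scalar ((aug f \<otimes> aug f) \<otimes> (aug f \<otimes> aug f))"
proof -
  let ?a = "(f \<otimes>\<^bsub>RG\<^esub> f) \<one>\<^bsub>G\<^esub>" and ?d = "(f \<otimes>\<^bsub>RG\<^esub> f) c"
  have ad: "?a \<in> carrier R" "?d \<in> carrier R" using f by auto
  have "?a \<oplus> ?d = aug (two_term c ?a ?d)" using ad c by (simp add: aug_two_term)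
  also have "two_term c ?a ?d = f \<otimes>\<^bsub>RG\<^esub> f" by (rule square_two_term[OF f, symmetric])
  finally have "?a \<oplus> ?d = aug f \<otimes> aug f" using f by simp
  moreover have "(f \<otimes>\<^bsub>RG\<^esub> f) \<otimes>\<^bsub>RG\<^esub> (f \<otimes>\<^bsub>RG\<^esub> f) = two_term c ?a ?d \<otimes>\<^bsub>RG\<^esub> two_term c ?a ?d"
    by (simp only: square_two_term[OF f, symmetric])
  ultimately show ?thesis using ad by (simp add: two_term_square)
qed

text \<open>The fourth power of f is the scalar e, the fourth power of its augmentation. If e is
  nonzero, the inverse of f is f^3 divided by e.\<close>

lemma Units_RG: "Units RG = {f \<in> carrier RG. aug f \<noteq> \<zero>}"
proof -
  interpret RG: comm_monoid RG by (rule RG_comm_monoid)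
  have "aug f \<noteq> \<zero>" if f: "f \<in> Units RG" for f
  proof
    assume "aug f = \<zero>"
    moreover have "aug (f \<otimes>\<^bsub>RG\<^esub> inv\<^bsub>RG\<^esub> f) = aug f \<otimes> aug (inv\<^bsub>RG\<^esub> f)"
      by (rule aug_mult) (use f RG.Units_closed in auto)
    ultimately have "aug \<one>\<^bsub>RG\<^esub> = \<zero>" using f RG.Units_closed by simp
    then show False by simp
  qed
  moreover have "f \<in> Units RG" if f: "f \<in> carrier RG" "aug f \<noteq> \<zero>" for f
  proof -
    let ?e = "(aug f \<otimes> aug f) \<otimes> (aug f \<otimes> aug f)"
    have "?e \<in> Units R" using f by (simp add: field_Units integral_iff)
    then have inv: "inv ?e \<in> carrier R" "?e \<otimes> inv ?e = \<one>" by auto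
    have "((f \<otimes>\<^bsub>RG\<^esub> f) \<otimes>\<^bsub>RG\<^esub> (f \<otimes>\<^bsub>RG\<^esub> f)) \<otimes>\<^bsub>RG\<^esub> scalar (inv ?e) = \<one>\<^bsub>RG\<^esub>"
      using f inv by (simp add: fourth_power scalar_mult one_two_term[of c])
    moreover define h where "h = f \<otimes>\<^bsub>RG\<^esub> (f \<otimes>\<^bsub>RG\<^esub> f) \<otimes>\<^bsub>RG\<^esub> scalar (inv ?e)"
    ultimately have "f \<otimes>\<^bsub>RG\<^esub> h = \<one>\<^bsub>RG\<^esub>"
      using f inv by (simp add: RG.m_assoc)
    moreover have "h \<in> carrier RG" using f inv by (simp add: h_def)
    moreover have "h \<otimes>\<^bsub>RG\<^esub> f = f \<otimes>\<^bsub>RG\<^esub> h" using f(1) calculation(2) by (rule RG_comm[symmetric])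
    ultimately show ?thesis using f(1) by (auto simp: Units_def)
  qed
  ultimately show ?thesis by auto
qed

section \<open>The unit group and its subgroup of augmentation 1\<close>

abbreviation U where "U \<equiv> units_of RG"

definition V where "V = {f \<in> carrier RG. aug f = \<one>}"

lemma U_comm_group: "comm_group U"
  by (rule comm_monoid.units_comm_group[OF RG_comm_monoid])

lemma carrier_U: "carrier U = {f \<in> carrier RG. aug f \<noteq> \<zero>}"
  by (simp add: units_of_carrier Units_RG)

lemma U_simps [simp]: "f \<otimes>\<^bsub>U\<^esub> h = f \<otimes>\<^bsub>RG\<^esub> h" "\<one>\<^bsub>U\<^esub> = \<one>\<^bsub>RG\<^esub>"
  by (simp_all add: units_of_mult units_of_one)

lemma finite_RG: "finite (carrier RG)"
  unfolding carrier_RG by (intro finite_PiE finite_G finite_R)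

lemma aug_hom: "aug \<in> hom U (units_of R)"
  by (rule homI) (auto simp: Units_RG units_of_carrier units_of_mult field_Units integral_iff)

lemma kernel_aug: "kernel U (units_of R) aug = V"
  by (auto simp: kernel_def Units_RG units_of_carrier units_of_one V_def)

lemma V_subgroup: "subgroup V U"
proof -
  interpret U: comm_group U by (rule U_comm_group)
  interpret aug: group_hom U "units_of R" aug
    using aug_hom units_group U.group_axioms by (simp add: group_hom_def group_hom_axioms_def)
  show ?thesis using aug.subgroup_kernel by (simp add: kernel_aug)
qed

text \<open>The augmentation maps the units onto the nonzero field elements, since scalars attain
  each of them, and its kernel is \<open>V\<close>.\<close>

lemma card_U: "card (carrier U) = card V * (card (carrier R) - 1)"
proof -
  interpret U: comm_group U by (rule U_comm_group)
  have "aug ` carrier U = carrier R - {\<zero>}"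
  proof
    show "aug ` carrier U \<subseteq> carrier R - {\<zero>}" by (auto simp: carrier_U)
    show "carrier R - {\<zero>} \<subseteq> aug ` carrier U"
    proof
      fix a assume "a \<in> carrier R - {\<zero>}"
      then show "a \<in> aug ` carrier U"
        by (intro image_eqI[of _ _ "scalar a"]) (auto simp: carrier_U aug_scalar)
    qed
  qed
  then have "card (aug ` carrier U) = card (carrier R) - 1" using finite_R by simp
  moreover have "finite (carrier U)" using finite_RG by (simp add: carrier_U)
  ultimately show ?thesis
    using U.card_eq_kernel_times_image[OF units_group aug_hom] by (simp add: kernel_aug)
qed

text \<open>Adding a to the coefficient at 1 adds a to the augmentation, so each element of the
  algebra comes from exactly one element of \<open>V\<close> and one shift.\<close>

lemma card_V: "card V * card (carrier R) = card (carrier R) ^ card (carrier G)"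
proof -
  let ?shift = "\<lambda>f a. f(\<one>\<^bsub>G\<^esub> := f \<one>\<^bsub>G\<^esub> \<oplus> a)"
  have closed: "?shift f a \<in> carrier RG" if "f \<in> carrier RG" "a \<in> carrier R" for f a
    using that by (auto simp: carrier_RG PiE_iff extensional_def)
  have aug_shift: "aug (?shift f a) = aug f \<oplus> a" if f: "f \<in> carrier RG" and a: "a \<in> carrier R" for f a
  proof -
    have "aug (?shift f a) = (\<Oplus>x\<in>carrier G. f x \<oplus> (if x = \<one>\<^bsub>G\<^esub> then a else \<zero>))"
      unfolding aug_def by (rule finsum_cong') (use f a in auto)
    also have "\<dots> = (\<Oplus>x\<in>carrier G. f x) \<oplus> (\<Oplus>x\<in>carrier G. if x = \<one>\<^bsub>G\<^esub> then a else \<zero>)"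
      by (rule finsum_addf) (use f a in auto)
    also have "(\<Oplus>x\<in>carrier G. if x = \<one>\<^bsub>G\<^esub> then a else \<zero>) = a"
      using a finite_G add.finprod_singleton_swap[of "\<one>\<^bsub>G\<^esub>" "carrier G" "\<lambda>_. a"] by simp
    finally show ?thesis by (simp add: aug_def)
  qed
  have shift_shift: "?shift (?shift f a) a = f" if "f \<in> carrier RG" "a \<in> carrier R" for f a
    using that by auto
  have "bij_betw (\<lambda>(f, a). ?shift f a) (V \<times> carrier R) (carrier RG)"
  \<comment> \<open>The shift that leads from augmentation \<open>aug f\<close> to 1 is
    \<open>aug f \<oplus> \<one>\<close>; as signs disappear in characteristic 2, shifting back uses
    the same amount.\<close>
  proof (rule bij_betw_byWitness[where f' = "\<lambda>f. (?shift f (aug f \<oplus> \<one>), aug f \<oplus> \<one>)"])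
    show "\<forall>p\<in>V \<times> carrier R. (\<lambda>f. (?shift f (aug f \<oplus> \<one>), aug f \<oplus> \<one>)) (case p of (f, a) \<Rightarrow> ?shift f a) = p"
    proof
      fix p assume "p \<in> V \<times> carrier R"
      then obtain f a where p: "p = (f, a)" "f \<in> carrier RG" "aug f = \<one>" "a \<in> carrier R" by (auto simp: V_def)
      have "aug (?shift f a) \<oplus> \<one> = a" using p by (simp add: aug_shift a_comm[of \<one>])
      then show "(\<lambda>f. (?shift f (aug f \<oplus> \<one>), aug f \<oplus> \<one>)) (case p of (f, a) \<Rightarrow> ?shift f a) = p"
        using shift_shift[OF p(2,4)] p(1) by simp
    qed
    show "\<forall>f\<in>carrier RG. (case (?shift f (aug f \<oplus> \<one>), aug f \<oplus> \<one>) of (f, a) \<Rightarrow> ?shift f a) = f"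
      using shift_shift by simp
    show "(\<lambda>(f, a). ?shift f a) ` (V \<times> carrier R) \<subseteq> carrier RG"
      using closed by (auto simp: V_def)
    have "?shift f (aug f \<oplus> \<one>) \<in> V" if f: "f \<in> carrier RG" for f
    proof -
      have "aug (?shift f (aug f \<oplus> \<one>)) = aug f \<oplus> (aug f \<oplus> \<one>)" using f by (simp add: aug_shift)
      also have "\<dots> = \<one>" using f by (simp add: a_assoc[symmetric] add_self)
      finally show ?thesis using f closed by (simp add: V_def)
    qed
    then show "(\<lambda>f. (?shift f (aug f \<oplus> \<one>), aug f \<oplus> \<one>)) ` carrier RG \<subseteq> V \<times> carrier R" by auto
  qed
  then have "card (V \<times> carrier R) = card (carrier RG)" by (rule bij_betw_same_card)
  then show ?thesis using finite_R by (simp add: card_cartesian_product card_RG)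
qed

text \<open>A square a + b c has augmentation a + b, which must be 1. Conversely, if d d = b, then
  (1 + d) + d \<open>x0\<close> has augmentation 1 and square (1 + b) + b c.\<close>

lemma squares_V: "(\<lambda>v. v \<otimes>\<^bsub>RG\<^esub> v) ` V = (\<lambda>b. two_term c (\<one> \<oplus> b) b) ` carrier R"
proof (intro equalityI subsetI)
  fix w assume "w \<in> (\<lambda>v. v \<otimes>\<^bsub>RG\<^esub> v) ` V"
  then obtain v where v: "v \<in> carrier RG" "aug v = \<one>" and w: "w = v \<otimes>\<^bsub>RG\<^esub> v" by (auto simp: V_def)
  let ?a = "w \<one>\<^bsub>G\<^esub>" and ?b = "w c"
  have ab: "?a \<in> carrier R" "?b \<in> carrier R" using v w by auto
  have weq: "w = two_term c ?a ?b" unfolding w by (rule square_two_term[OF v(1)])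
  have "?a \<oplus> ?b = aug (two_term c ?a ?b)" using ab c by (simp add: aug_two_term)
  also have "\<dots> = aug w" by (simp only: weq[symmetric])
  also have "\<dots> = \<one>" using v by (simp add: w)
  finally have "?a = \<one> \<oplus> ?b" using ab add_cancel by metis
  then show "w \<in> (\<lambda>b. two_term c (\<one> \<oplus> b) b) ` carrier R"
    using weq ab by (intro image_eqI[of _ _ ?b]) auto
next
  fix w assume "w \<in> (\<lambda>b. two_term c (\<one> \<oplus> b) b) ` carrier R"
  then obtain b where b: "b \<in> carrier R" "w = two_term c (\<one> \<oplus> b) b" by auto
  obtain d where d: "d \<in> carrier R" "d \<otimes> d = b" using exists_sqrt[OF b(1)] by blast
  have "w = two_term x0 (\<one> \<oplus> d) d \<otimes>\<^bsub>RG\<^esub> two_term x0 (\<one> \<oplus> d) d"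
    using d b by (simp add: two_term_square square_add)
  moreover have "two_term x0 (\<one> \<oplus> d) d \<in> V"
    using d x0(1) x0_not_one by (simp add: V_def aug_two_term)
  ultimately show "w \<in> (\<lambda>v. v \<otimes>\<^bsub>RG\<^esub> v) ` V" by blast
qed

lemma card_squares_V: "card ((\<lambda>v. v \<otimes>\<^bsub>RG\<^esub> v) ` V) = card (carrier R)"
  unfolding squares_V
proof (rule card_image, rule inj_onI)
  fix b b' assume "two_term c (\<one> \<oplus> b) b = two_term c (\<one> \<oplus> b') b'"
  then have "two_term c (\<one> \<oplus> b) b c = two_term c (\<one> \<oplus> b') b' c" by simp
  then show "b = b'" using c by simp
qed

text \<open>With |G| = m + 3 the subgroup \<open>V\<close> has \<open>q^(m+2)\<close> elements. The
  factor \<open>C_4^n\<close> accounts for \<open>q^2\<close> of them, which leaves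
  \<open>q^m\<close>, that is, m n factors \<open>C_2\<close>.\<close>

theorem units_iso:
  assumes q: "card (carrier R) = 2 ^ n" and N: "card (carrier G) = m + 3"
  shows "U \<cong> cyclic_power 4 n \<times>\<times> cyclic_power 2 (m * n) \<times>\<times> integer_mod_group (2 ^ n - 1)"
proof -
  interpret U: comm_group U by (rule U_comm_group)
  let ?C = "cyclic_power 4 n \<times>\<times> cyclic_power 2 (m * n) \<times>\<times> integer_mod_group (2 ^ n - 1)"
  have "units_of R \<cong> integer_mod_group (2 ^ n - 1)"
    using units_of_iso_integer_mod_group[OF finite_R] q by simp
  then have "integer_mod_group (2 ^ n - 1) \<cong> units_of R"
    by (rule group.iso_sym[OF units_group])
  then obtain \<theta> where \<theta>: "\<theta> \<in> hom (integer_mod_group (2 ^ n - 1)) (units_of R)"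
    and \<theta>_surj: "\<theta> ` carrier (integer_mod_group (2 ^ n - 1)) = Units R"
    by (auto simp: is_iso_def iso_def bij_betw_def units_of_carrier)
  have scalar_hom: "scalar \<in> hom (units_of R) U"
    by (rule homI)
       (auto simp: Units_RG units_of_carrier units_of_mult field_Units aug_scalar scalar_mult)
  have "?C \<cong> U"
  proof (rule U.iso_of_exponent_4_times_cyclic[OF V_subgroup, where \<theta> = "scalar \<circ> \<theta>"])
    show "finite V" using finite_RG by (simp add: V_def)
    show "(x \<otimes>\<^bsub>U\<^esub> x) \<otimes>\<^bsub>U\<^esub> (x \<otimes>\<^bsub>U\<^esub> x) = \<one>\<^bsub>U\<^esub>" if "x \<in> V" for x
      using that by (simp add: V_def fourth_power one_two_term[of c])
    show "card ((\<lambda>x. x \<otimes>\<^bsub>U\<^esub> x) ` V) = 2 ^ n"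
      using card_squares_V q by simp
    have "card V * 2 ^ n = (2 ^ n) ^ (m + 3)" using card_V q N by simp
    also have "\<dots> = 2 ^ (2 * n + m * n) * 2 ^ n"
      by (simp add: power_mult[symmetric] power_add[symmetric] algebra_simps)
    finally show "card V = 2 ^ (2 * n + m * n)" by simp
    show "scalar \<circ> \<theta> \<in> hom (integer_mod_group (2 ^ n - 1)) U"
      by (rule hom_compose[OF \<theta> scalar_hom])
    show "card (carrier U) = card V * (2 ^ n - 1)" using card_U q by simp
    show "0 < (2 ^ n - 1 :: nat)"
    proof -
      have "card {\<zero>, \<one>} \<le> card (carrier R)" by (rule card_mono[OF finite_R]) auto
      then show ?thesis using q by simp
    qed
    fix f assume "f \<in> carrier U"
    then have f: "f \<in> carrier RG" "aug f \<in> Units R" by (simp_all add: carrier_U field_Units)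
    then have "aug f \<in> \<theta> ` carrier (integer_mod_group (2 ^ n - 1))" using \<theta>_surj by simp
    then obtain z where z: "z \<in> carrier (integer_mod_group (2 ^ n - 1))" "\<theta> z = aug f" by (elim imageE) simp
    \<comment> \<open>Splits f into the scalar \<open>aug f\<close>, which lies in the image of the
      cyclic factor, and a unit of augmentation 1.\<close>
    let ?v = "scalar (inv (aug f)) \<otimes>\<^bsub>RG\<^esub> f"
    have "scalar (aug f) \<otimes>\<^bsub>RG\<^esub> ?v = f"
      by (rule RG_eqI) (use f in \<open>auto simp: scalar_mult_apply simp flip: m_assoc\<close>)
    moreover have "?v \<in> V" using f by (simp add: V_def aug_scalar)
    ultimately show "\<exists>z\<in>carrier (integer_mod_group (2 ^ n - 1)). \<exists>v\<in>V. f = (scalar \<circ> \<theta>) z \<otimes>\<^bsub>U\<^esub> v"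
      using z by (intro bexI[of _ z] bexI[of _ ?v]) simp_all
  qed
  moreover have "group ?C" by (intro DirProd_group product_group group_integer_mod_group)
  ultimately show ?thesis by (rule group.iso_sym[rotated])
qed

end

section \<open>The characteristic, and the three cases of the theorem\<close>

lemma (in ring) two_of_characteristic:
  assumes p: "prime p" "ring_characteristic R = p"
  shows "\<one> \<oplus> \<one> = \<zero> \<longleftrightarrow> p = 2"
proof -
  let ?P = "\<lambda>k::nat. k > 0 \<and> [k] \<cdot> \<one> = \<zero>"
  \<comment> \<open>As p is prime, it is not the default value 0 of
    \<open>ring_characteristic\<close>, so it is the least positive multiple of 1 that
    vanishes.\<close>
  have ex: "\<exists>k. ?P k" and pL: "p = (LEAST k. ?P k)"
    using p unfolding ring_characteristic_def by (auto split: if_splits)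
  have "?P p" unfolding pL using ex by (rule LeastI_ex)
  have two: "[(2::nat)] \<cdot> \<one> = \<one> \<oplus> \<one>" by (simp add: numeral_2_eq_2)
  show ?thesis
  proof
    assume "\<one> \<oplus> \<one> = \<zero>"
    with two have "p \<le> 2" unfolding pL by (intro Least_le) simp
    with prime_ge_2_nat[OF p(1)] show "p = 2" by simp
  next
    assume "p = 2"
    with \<open>?P p\<close> two show "\<one> \<oplus> \<one> = \<zero>" by simp
  qed
qed

theorem theorem3p6:
  fixes F :: "('a, 'b) ring_scheme" and p n q :: nat
  assumes "prime p" and "n \<ge> 1"
    and "field F" and "finite (carrier F)" and "ring_characteristic F = p"
    and "q = p ^ n" and "card (carrier F) = q"
  shows "(p = 2 \<longrightarrow>
            units_of (group_algebra F (integer_mod_group 4 \<times>\<times> cyclic_power 2 3))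
              \<cong> cyclic_power 4 n \<times>\<times> cyclic_power 2 (29 * n) \<times>\<times> integer_mod_group (2 ^ n - 1))
       \<and> (p \<noteq> 2 \<longrightarrow>
            ([q = 1] (mod 4) \<longrightarrow>
              units_of (group_algebra F (integer_mod_group 4 \<times>\<times> cyclic_power 2 3))
                \<cong> cyclic_power (p ^ n - 1) 32)
          \<and> ([int q = - 1] (mod 4) \<longrightarrow>
              units_of (group_algebra F (integer_mod_group 4 \<times>\<times> cyclic_power 2 3))
                \<cong> cyclic_power (p ^ n - 1) 16 \<times>\<times> cyclic_power (p ^ (2 * n) - 1) 8))"
proof -
  interpret F: field F by fact
  have two: "\<one>\<^bsub>F\<^esub> \<oplus>\<^bsub>F\<^esub> \<one>\<^bsub>F\<^esub> = \<zero>\<^bsub>F\<^esub> \<longleftrightarrow> p = 2"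
    by (rule F.two_of_characteristic) fact+
  have card_F: "card (carrier F) = p ^ n" using assms by simp
  show ?thesis
  proof (intro conjI impI)
    assume "p = 2"
    \<comment> \<open>The element \<open>?x\<close> generates the factor \<open>C_4\<close>, and
      \<open>?c\<close> is its square.\<close>
    let ?c = "(2, \<lambda>k\<in>{..<3::nat}. 0) :: int \<times> (nat \<Rightarrow> int)"
    let ?x = "(1, \<lambda>k\<in>{..<3::nat}. 0) :: int \<times> (nat \<Rightarrow> int)"
    interpret G: comm_group C4xC2cube by (rule comm_group_C4xC2cube)
    interpret char_two_group_algebra F C4xC2cube ?c ?x
    proof
      show "finite (carrier C4xC2cube)" by (rule finite_C4xC2cube)
      show "finite (carrier F)" by fact
      show "\<one>\<^bsub>F\<^esub> \<oplus>\<^bsub>F\<^esub> \<one>\<^bsub>F\<^esub> = \<zero>\<^bsub>F\<^esub>" using two \<open>p = 2\<close> by simp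
      show "?c \<noteq> \<one>\<^bsub>C4xC2cube\<^esub>" by simp
      show "?x \<in> carrier C4xC2cube" by (auto simp: carrier_integer_mod_group)
      show "?x \<otimes>\<^bsub>C4xC2cube\<^esub> ?x = ?c" by (auto intro!: restrict_ext)
      fix y assume "y \<in> carrier C4xC2cube"
      have "y \<otimes>\<^bsub>C4xC2cube\<^esub> y = ((2 * fst y) mod 4, \<lambda>k\<in>{..<3}. 0)"
        by (auto simp: mult_DirProd' intro!: restrict_ext)
      moreover have "(2 * fst y) mod 4 = 0 \<or> (2 * fst y) mod 4 = 2" by presburger
      ultimately show "y \<otimes>\<^bsub>C4xC2cube\<^esub> y = \<one>\<^bsub>C4xC2cube\<^esub> \<or> y \<otimes>\<^bsub>C4xC2cube\<^esub> y = ?c" by auto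
    qed
    \<comment> \<open>The order 32 is written so as to match m + 3 with m = 29.\<close>
    have "card (carrier C4xC2cube) = 29 + 3"
      unfolding carrier_C4xC2cube card_times_C2cube by simp
    with card_F \<open>p = 2\<close>
    show "units_of (group_algebra F C4xC2cube)
        \<cong> cyclic_power 4 n \<times>\<times> cyclic_power 2 (29 * n) \<times>\<times> integer_mod_group (2 ^ n - 1)"
      by (intro units_iso) simp_all
  next
    assume "p \<noteq> 2" and q: "[q = 1] (mod 4)"
    have "card (carrier F) mod 4 = 1" using q assms by (simp add: cong_def)
    then show "units_of (group_algebra F C4xC2cube) \<cong> cyclic_power (p ^ n - 1) 32"
      using units_group_algebra_1_mod_4[OF \<open>field F\<close> \<open>finite (carrier F)\<close>] two \<open>p \<noteq> 2\<close> card_F by simp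
  next
    assume "p \<noteq> 2" and q: "[int q = - 1] (mod 4)"
    have "int (q mod 4) = 3" using q by (simp add: cong_def zmod_int)
    then have "card (carrier F) mod 4 = 3" using assms by simp
    moreover have "(p ^ n)\<^sup>2 = p ^ (2 * n)" by (simp add: power_mult mult.commute flip: power_mult)
    ultimately show "units_of (group_algebra F C4xC2cube)
        \<cong> cyclic_power (p ^ n - 1) 16 \<times>\<times> cyclic_power (p ^ (2 * n) - 1) 8"
      using units_group_algebra_3_mod_4[OF \<open>field F\<close> \<open>finite (carrier F)\<close>] two \<open>p \<noteq> 2\<close> card_F by simp
  qed
qed

end
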